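(* The following metric $ds^2$ on $\mathbb{D}_n\times\mathbb{C}^{(m,n)}$, defined by \begin{eqnarray*} \tfrac14\,ds^2&=&\mathrm{tr}\big((I_n-W\overline{W})^{-1}dW(I_n-\overline{W}W)^{-1}d\overline{W}\big)+\mathrm{tr}\big((I_n-W\overline{W})^{-1}\,{}^t(d\eta)\,d\overline{\eta}\big)\\ &&+\,\mathrm{tr}\big((\eta\overline{W}-\overline{\eta})(I_n-W\overline{W})^{-1}dW(I_n-\overline{W}W)^{-1}\,{}^t(d\overline{\eta})\big)\\ &&+\,\mathrm{tr}\big((\overline{\eta}W-\eta)(I_n-\overline{W}W)^{-1}d\overline{W}(I_n-W\overline{W})^{-1}\,{}^t(d\eta)\big)\\ &&-\,\mathrm{tr}\big((I_n-W\overline{W})^{-1}\,{}^t\eta\,\eta\,(I_n-\overline{W}W)^{-1}\overline{W}\,dW(I_n-\overline{W}W)^{-1}d\overline{W}\big)\\ &&-\,\mathrm{tr}\big(W(I_n-\overline{W}W)^{-1}\,{}^t\overline{\eta}\,\overline{\eta}\,(I_n-W\overline{W})^{-1}dW(I_n-\overline{W}W)^{-1}d\overline{W}\big)\\ &&+\,\mathrm{tr}\big((I_n-W\overline{W})^{-1}\,{}^t\eta\,\overline{\eta}\,(I_n-W\overline{W})^{-1}dW(I_n-\overline{W}W)^{-1}d\overline{W}\big)\\ &&+\,\mathrm{tr}\big((I_n-\overline{W})^{-1}\,{}^t\overline{\eta}\,\eta\,\overline{W}(I_n-W\overline{W})^{-1}dW(I_n-\overline{W}W)^{-1}d\overline{W}\big)\\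 &&+\,\mathrm{tr}\big((I_n-\overline{W})^{-1}(I_n-W)(I_n-\overline{W}W)^{-1}\,{}^t\overline{\eta}\,\eta\,(I_n-\overline{W}W)^{-1}(I_n-\overline{W})(I_n-W)^{-1}dW(I_n-\overline{W}W)^{-1}d\overline{W}\big)\\ &&-\,\mathrm{tr}\big((I_n-W\overline{W})^{-1}(I_n-W)(I_n-\overline{W})^{-1}\,{}^t\overline{\eta}\,\eta\,(I_n-W)^{-1}dW(I_n-\overline{W}W)^{-1}d\overline{W}\big) \end{eqnarray*} is a Riemannian metric on $\mathbb{D}_n\times\mathbb{C}^{(m,n)}$ which is invariant under the action of the Jacobi group $G^J_*$ given by $$\left(\begin{pmatrix}P&Q\\ \overline{Q}&\overline{P}\end{pmatrix},(\xi,\overline{\xi};i\kappa)\right)\cdot(W,\eta)=\big((PW+Q)(\overline{Q}W+\overline{P})^{-1},\,(\eta+\xi W+\overline{\xi})(\overline{Q}W+\overline{P})^{-1}\big).$$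
   Context: Fix positive integers $n,m$. $\mathbb{D}_n=\{W\in\mathbb{C}^{(n,n)}: W={}^tW,\ I_n-\overline{W}W>0\}$ is the generalized unit disk; coordinates $(W,\eta)\in\mathbb{D}_n\times\mathbb{C}^{(m,n)}$ with $W=(w_{\mu\nu})$, $\eta=(\eta_{kl})$, $dW=(dw_{\mu\nu})$, $d\overline{W}=(d\overline{w}_{\mu\nu})$, $d\eta=(d\eta_{kl})$, $d\overline{\eta}=(d\overline{\eta}_{kl})$. The Jacobi group $G^J=Sp(n,\mathbb{R})\ltimes H_{\mathbb{R}}^{(n,m)}$ (semidirect product of the symplectic group with the Heisenberg group $H_{\mathbb{R}}^{(n,m)}=\{(\lambda,\mu;\kappa):\lambda,\mu\in\mathbb{R}^{(m,n)},\kappa\in\mathbb{R}^{(m,m)},\ \kappa+\mu\,{}^t\lambda\text{ symmetric}\}$) is embedded in $Sp(m+n,\mathbb{R})$, and $G^J_*=T_*^{-1}G^JT_*$ with $T_*=\frac{1}{\sqrt2}\begin{pmatrix}I_{m+n}&I_{m+n}\\ iI_{m+n}&-iI_{m+n}\end{pmatrix}$. Its elements are $(M_*,(\xi,\overline{\xi};i\kappa))$ with $M_*=\begin{pmatrix}P&Q\\ \overline{Q}&\overline{P}\end{pmatrix}\in G_*=T^{-1}Sp(n,\mathbb{R})T$, $T=\frac1{\sqrt2}\begin{pmatrix}I_n&iI_n\\ iI_n&-iI_n\end{pmatrix}$, $\xi\in\mathbb{C}^{(m,n)}$, $\kappa\in\mathbb{R}^{(m,m)}$. (The metric is obtained by pulling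 back, via the partial Cayley transform $\Phi_*(W,\eta)=(i(I_n+W)(I_n-W)^{-1},2i\eta(I_n-W)^{-1})$, a $G^J$-invariant metric on $\mathbb{H}_n\times\mathbb{C}^{(m,n)}$.) *)

theory Defs
  imports "HOL-Analysis.Analysis"
begin

section \<open>Matrices\<close>

text \<open>An \<open>m\<close> by \<open>n\<close> matrix has type \<open>'a ^ 'n ^ 'm\<close>
  (rows indexed by \<open>'m\<close>, columns by \<open>'n\<close>).\<close>

abbreviation cnj_mat :: "complex ^ 'n ^ 'm \<Rightarrow> complex ^ 'n ^ 'm"
  where "cnj_mat \<equiv> map_matrix cnj"

abbreviation of_real_mat :: "real ^ 'n ^ 'm \<Rightarrow> complex ^ 'n ^ 'm"
  where "of_real_mat \<equiv> map_matrix complex_of_real"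

definition block_mat ::
  "'a ^ 'c::finite ^ 'r::finite \<Rightarrow> 'a ^ 'd::finite ^ 'r \<Rightarrow> 'a ^ 'c ^ 's::finite \<Rightarrow>
   'a ^ 'd ^ 's \<Rightarrow> 'a ^ ('c + 'd) ^ ('r + 's)"
  where "block_mat A B C D =
    (\<chi> i j. case i of
        Inl r \<Rightarrow> (case j of Inl c \<Rightarrow> A $ r $ c | Inr d \<Rightarrow> B $ r $ d)
      | Inr s \<Rightarrow> (case j of Inl c \<Rightarrow> C $ s $ c | Inr d \<Rightarrow> D $ s $ d))"

definition block11 :: "'a ^ ('c::finite + 'd::finite) ^ ('r::finite + 's::finite) \<Rightarrow> 'a ^ 'c ^ 'r"
  where "block11 X = (\<chi> i j. X $ Inl i $ Inl j)"

definition block12 :: "'a ^ ('c::finite + 'd::finite) ^ ('r::finite + 's::finite) \<Rightarrow> 'a ^ 'd ^ 'r"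
  where "block12 X = (\<chi> i j. X $ Inl i $ Inr j)"

definition block21 :: "'a ^ ('c::finite + 'd::finite) ^ ('r::finite + 's::finite) \<Rightarrow> 'a ^ 'c ^ 's"
  where "block21 X = (\<chi> i j. X $ Inr i $ Inl j)"

definition block22 :: "'a ^ ('c::finite + 'd::finite) ^ ('r::finite + 's::finite) \<Rightarrow> 'a ^ 'd ^ 's"
  where "block22 X = (\<chi> i j. X $ Inr i $ Inr j)"

definition hermitian_pos_def :: "complex ^ 'n ^ 'n \<Rightarrow> bool"
  where "hermitian_pos_def A \<longleftrightarrow>
    transpose (cnj_mat A) = A \<and>
    (\<forall>x. x \<noteq> 0 \<longrightarrow> 0 < Re (\<Sum>i\<in>UNIV. cnj (x $ i) * (A *v x) $ i))"

section \<open>Riemannian metrics on relatively open subsets of a linear subspace\<close>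

fun Ck_on :: "nat \<Rightarrow> ('a::real_normed_vector \<Rightarrow> 'b::real_normed_vector) \<Rightarrow> 'a set \<Rightarrow> bool" where
  "Ck_on 0 f U \<longleftrightarrow> continuous_on U f"
| "Ck_on (Suc k) f U \<longleftrightarrow>
     (\<forall>x\<in>U. f differentiable (at x)) \<and>
     (\<forall>v. Ck_on k (\<lambda>x. frechet_derivative f (at x) v) U)"

text \<open>Smoothness on a subset that need not be open in the ambient space:
  existence of local smooth extensions.\<close>

definition smooth_fun_on :: "'a::real_normed_vector set \<Rightarrow> ('a \<Rightarrow> 'b::real_normed_vector) \<Rightarrow> bool"
  where "smooth_fun_on S f \<longleftrightarrow>
    (\<forall>p\<in>S. \<exists>U F. open U \<and> p \<in> U \<and> (\<forall>k. Ck_on k F U) \<and> (\<forall>x\<in>S \<inter> U. F x = f x))"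

text \<open>The manifold is \<open>S\<close>, open in the linear subspace \<open>T\<close>, so every
  tangent space is \<open>T\<close>. In \<open>g p u v\<close> the point is \<open>p\<close> and the
  tangent vectors are \<open>u\<close> and \<open>v\<close>; values of \<open>g\<close> off \<open>S\<close> and \<open>T\<close> are irrelevant.\<close>

definition riemannian_metric_on ::
  "'a::real_normed_vector set \<Rightarrow> 'a set \<Rightarrow> ('a \<Rightarrow> 'a \<Rightarrow> 'a \<Rightarrow> real) \<Rightarrow> bool"
  where "riemannian_metric_on S T g \<longleftrightarrow>
    subspace T \<and> openin (top_of_set T) S \<and>
    (\<forall>p\<in>S.
      (\<forall>u\<in>T. \<forall>v\<in>T. \<forall>w\<in>T. g p (u + v) w = g p u w + g p v w) \<and>
      (\<forall>c. \<forall>u\<in>T. \<forall>v\<in>T. g p (c *\<^sub>R u) v = c * g p u v) \<and>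
      (\<forall>u\<in>T. \<forall>v\<in>T. g p u v = g p v u) \<and>
      (\<forall>u\<in>T. u \<noteq> 0 \<longrightarrow> 0 < g p u u)) \<and>
    (\<forall>u\<in>T. \<forall>v\<in>T. smooth_fun_on S (\<lambda>p. g p u v))"

text \<open>\<open>\<phi>\<close> maps \<open>S\<close> to itself and pulls \<open>g\<close> back to itself. The restriction to \<open>T\<close>
  of the derivative within \<open>S\<close> is unique, because \<open>S\<close> is open in \<open>T\<close>.\<close>

definition metric_invariant_under ::
  "'a::real_normed_vector set \<Rightarrow> 'a set \<Rightarrow> ('a \<Rightarrow> 'a \<Rightarrow> 'a \<Rightarrow> real) \<Rightarrow> ('a \<Rightarrow> 'a) \<Rightarrow> bool"
  where "metric_invariant_under S T g \<phi> \<longleftrightarrow>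
    \<phi> ` S \<subseteq> S \<and>
    (\<forall>p\<in>S. \<exists>D. (\<phi> has_derivative D) (at p within S) \<and>
      (\<forall>u\<in>T. \<forall>v\<in>T. g (\<phi> p) (D u) (D v) = g p u v))"

section \<open>The Siegel-Jacobi disk\<close>

type_synonym ('n, 'm) sj_space = "(complex ^ 'n ^ 'n) \<times> (complex ^ 'n ^ 'm)"

definition generalized_unit_disk :: "(complex ^ 'n::finite ^ 'n) set"
  where "generalized_unit_disk =
    {W. W = transpose W \<and> hermitian_pos_def (mat 1 - cnj_mat W ** W)}"

definition siegel_jacobi_disk :: "('n::finite, 'm::finite) sj_space set"
  where "siegel_jacobi_disk = generalized_unit_disk \<times> UNIV"

definition siegel_jacobi_tangent :: "('n::finite, 'm::finite) sj_space set"
  where "siegel_jacobi_tangent = {W. W = transpose W} \<times> UNIV"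

text \<open>The expression for a quarter of \<open>ds\<^sup>2\<close> at \<open>(W, \<eta>)\<close>, with \<open>dW\<close>, \<open>dW'\<close>, \<open>d\<eta>\<close>, \<open>d\<eta>'\<close>
  standing for the matrices of differentials \<open>dW\<close>, \<open>d(cnj W)\<close>, \<open>d\<eta>\<close>, \<open>d(cnj \<eta>)\<close>.\<close>

definition quarter_ds2 ::
  "complex ^ 'n::finite ^ 'n \<Rightarrow> complex ^ 'n ^ 'm::finite \<Rightarrow>
   complex ^ 'n ^ 'n \<Rightarrow> complex ^ 'n ^ 'n \<Rightarrow> complex ^ 'n ^ 'm \<Rightarrow> complex ^ 'n ^ 'm \<Rightarrow> complex"
  where "quarter_ds2 W \<eta> dW dW' d\<eta> d\<eta>' =
    (let I = mat 1; W' = cnj_mat W; \<eta>' = cnj_mat \<eta>;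
         X = matrix_inv (I - W ** W'); Y = matrix_inv (I - W' ** W)
     in
       trace (X ** dW ** Y ** dW')
     + trace (X ** transpose d\<eta> ** d\<eta>')
     + trace ((\<eta> ** W' - \<eta>') ** X ** dW ** Y ** transpose d\<eta>')
     + trace ((\<eta>' ** W - \<eta>) ** Y ** dW' ** X ** transpose d\<eta>)
     - trace (X ** transpose \<eta> ** \<eta> ** Y ** W' ** dW ** Y ** dW')
     - trace (W ** Y ** transpose \<eta>' ** \<eta>' ** X ** dW ** Y ** dW')
     + trace (X ** transpose \<eta> ** \<eta>' ** X ** dW ** Y ** dW')
     + trace (matrix_inv (I - W') ** transpose \<eta>' ** \<eta> ** W' ** X ** dW ** Y ** dW')
     + trace (matrix_inv (I - W') ** (I - W) ** Y ** transpose \<eta>' ** \<eta> ** Y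
              ** (I - W') ** matrix_inv (I - W) ** dW ** Y ** dW')
     - trace (X ** (I - W) ** matrix_inv (I - W') ** transpose \<eta>' ** \<eta>
              ** matrix_inv (I - W) ** dW ** Y ** dW'))"

text \<open>Each product of a holomorphic and an antiholomorphic differential is a symmetric
  product \<open>\<alpha> \<beta> = (\<alpha> \<otimes> \<beta> + \<beta> \<otimes> \<alpha>) / 2\<close>. The value is a priori complex.\<close>

definition siegel_jacobi_ds2 ::
  "('n::finite, 'm::finite) sj_space \<Rightarrow> ('n, 'm) sj_space \<Rightarrow> ('n, 'm) sj_space \<Rightarrow> complex"
  where "siegel_jacobi_ds2 p u v =
    (let h = (\<lambda>a b. quarter_ds2 (fst p) (snd p)
                      (fst a) (cnj_mat (fst b)) (snd a) (cnj_mat (snd b)))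
     in 4 * ((h u v + h v u) / 2))"

section \<open>The Jacobi group and its action\<close>

type_synonym ('a, 'n, 'm) jacobi_mat = "'a ^ (('n + 'm) + ('n + 'm)) ^ (('n + 'm) + ('n + 'm))"
type_synonym ('n, 'm) heisenberg = "(real ^ 'n ^ 'm) \<times> (real ^ 'n ^ 'm) \<times> (real ^ 'm ^ 'm)"

definition symplectic_group :: "(real ^ ('n::finite + 'n) ^ ('n + 'n)) set"
  where "symplectic_group =
    (let J = block_mat 0 (mat 1) (- mat 1) 0 in {M. transpose M ** J ** M = J})"

definition heisenberg_group :: "('n::finite, 'm::finite) heisenberg set"
  where "heisenberg_group =
    {(l, \<mu>, \<kappa>). transpose (\<kappa> + \<mu> ** transpose l) = \<kappa> + \<mu> ** transpose l}"

text \<open>The standard embedding of \<open>(M, (l, \<mu>; \<kappa>))\<close>, \<open>M = (A, B; C, D)\<close>, into the symplectic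
  group of degree \<open>n + m\<close>, as the product of the images of \<open>M\<close> and \<open>(l, \<mu>; \<kappa>)\<close>:
    (A, 0, B, A \<mu>^t - B l^t;  l, 1, \<mu>, \<kappa>;  C, 0, D, C \<mu>^t - D l^t;  0, 0, 0, 1).\<close>

definition jacobi_embedding ::
  "real ^ ('n::finite + 'n) ^ ('n + 'n) \<Rightarrow> ('n, 'm::finite) heisenberg \<Rightarrow> (real, 'n, 'm) jacobi_mat"
  where "jacobi_embedding M h = (case h of (l, \<mu>, \<kappa>) \<Rightarrow>
    block_mat (block_mat (block11 M) 0 l (mat 1))
              (block_mat (block12 M) (block11 M ** transpose \<mu> - block12 M ** transpose l) \<mu> \<kappa>)
              (block_mat (block21 M) 0 0 0)
              (block_mat (block22 M) (block21 M ** transpose \<mu> - block22 M ** transpose l) 0 (mat 1)))"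

definition jacobi_group :: "(real, 'n::finite, 'm::finite) jacobi_mat set"
  where "jacobi_group =
    {jacobi_embedding M h | M h. M \<in> symplectic_group \<and> h \<in> heisenberg_group}"

definition cayley_mat :: "complex ^ ('k::finite + 'k) ^ ('k + 'k)"
  where "cayley_mat =
    (\<chi> i j. block_mat (mat 1) (mat 1) (mat \<i>) (mat (- \<i>)) $ i $ j / complex_of_real (sqrt 2))"

definition jacobi_group_star :: "(complex, 'n::finite, 'm::finite) jacobi_mat set"
  where "jacobi_group_star =
    {matrix_inv cayley_mat ** of_real_mat g ** cayley_mat | g. g \<in> jacobi_group}"

text \<open>An element \<open>X\<close> of \<open>jacobi_group_star\<close> is written \<open>((P, Q; cnj Q, cnj P), (\<xi>, cnj \<xi>; i \<kappa>))\<close>;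
  \<open>P\<close>, \<open>Q\<close> and \<open>\<xi>\<close> are blocks of \<open>X\<close>.\<close>

definition jacobi_P :: "(complex, 'n::finite, 'm::finite) jacobi_mat \<Rightarrow> complex ^ 'n ^ 'n"
  where "jacobi_P X = block11 (block11 X)"

definition jacobi_Q :: "(complex, 'n::finite, 'm::finite) jacobi_mat \<Rightarrow> complex ^ 'n ^ 'n"
  where "jacobi_Q X = block11 (block12 X)"

definition jacobi_xi :: "(complex, 'n::finite, 'm::finite) jacobi_mat \<Rightarrow> complex ^ 'n ^ 'm"
  where "jacobi_xi X = block21 (block11 X)"

definition jacobi_action ::
  "(complex, 'n::finite, 'm::finite) jacobi_mat \<Rightarrow> ('n, 'm) sj_space \<Rightarrow> ('n, 'm) sj_space"
  where "jacobi_action X p = (case p of (W, \<eta>) \<Rightarrow>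
    let P = jacobi_P X; Q = jacobi_Q X; \<xi> = jacobi_xi X;
        R = matrix_inv (cnj_mat Q ** W + cnj_mat P)
    in ((P ** W + Q) ** R, (\<eta> + \<xi> ** W + cnj_mat \<xi>) ** R))"

section \<open>Coordinates on the conjugated Jacobi group\<close>

lemma sum_UNIV_Plus:
  fixes f :: "'a::finite + 'b::finite \<Rightarrow> 'c::comm_monoid_add"
  shows "sum f UNIV = (\<Sum>i\<in>UNIV. f (Inl i)) + (\<Sum>i\<in>UNIV. f (Inr i))"
  by (simp add: UNIV_Plus_UNIV[symmetric] sum.Plus comp_def del: UNIV_Plus_UNIV)

lemma block_mat_mult:
  "block_mat A B C D ** block_mat A' B' C' D' =
   block_mat (A ** A' + B ** C') (A ** B' + B ** D') (C ** A' + D ** C') (C ** B' + D ** D')"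
  by (auto simp: vec_eq_iff block_mat_def matrix_matrix_mult_def sum_UNIV_Plus split: sum.splits)

lemma block_mat_blocks:
  "block_mat (block11 X) (block12 X) (block21 X) (block22 X) = X"
  by (auto simp: vec_eq_iff block_mat_def block11_def block12_def block21_def block22_def
      split: sum.splits)

lemma blocks_block_mat [simp]:
  "block11 (block_mat A B C D) = A" "block12 (block_mat A B C D) = B"
  "block21 (block_mat A B C D) = C" "block22 (block_mat A B C D) = D"
  by (simp_all add: vec_eq_iff block_mat_def block11_def block12_def block21_def block22_def)

lemma mat_1_block: "mat 1 = block_mat (mat 1) 0 0 (mat 1)"
  by (auto simp: vec_eq_iff block_mat_def mat_def split: sum.splits)

lemma mat_mult_left:
  "mat c ** A = (\<chi> i j. c * A $ i $ j)" for A :: "'a::semiring_1 ^ 'n::finite ^ 'm::finite"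
  by (simp add: vec_eq_iff matrix_matrix_mult_def mat_def if_distrib[of "\<lambda>x. x * _"] cong: if_cong)

lemma mat_mult_right:
  "A ** mat c = (\<chi> i j. A $ i $ j * c)" for A :: "'a::semiring_1 ^ 'n::finite ^ 'm::finite"
  by (simp add: vec_eq_iff matrix_matrix_mult_def mat_def if_distrib[of "\<lambda>x. _ * x"] cong: if_cong)

lemma cayley_mat_alt:
  "cayley_mat = (let s = complex_of_real (1 / sqrt 2) in
     block_mat (mat s) (mat s) (mat (s * \<i>)) (mat (- s * \<i>)))"
  by (auto simp: vec_eq_iff cayley_mat_def block_mat_def mat_def Let_def split: sum.splits)

lemma sqrt2_sq: "complex_of_real (sqrt 2) * complex_of_real (sqrt 2) = 2"
  by (simp flip: of_real_mult)

lemma matrix_inv_cayley: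
  "matrix_inv (cayley_mat :: complex ^ ('k + 'k) ^ ('k::finite + 'k)) =
    (let s = complex_of_real (1 / sqrt 2) in
     block_mat (mat s) (mat (- s * \<i>)) (mat s) (mat (s * \<i>)))" (is "_ = ?B")
proof -
  have 1: "cayley_mat ** ?B = mat 1"
    unfolding cayley_mat_alt Let_def block_mat_mult mat_1_block mat_mult_left
    by (auto simp: vec_eq_iff block_mat_def mat_def sqrt2_sq field_simps split: sum.splits)
  then have 2: "?B ** cayley_mat = mat 1"
    using matrix_left_right_inverse by blast
  have inv: "invertible (cayley_mat :: complex ^ ('k + 'k) ^ ('k + 'k))"
    using 1 2 unfolding invertible_def by blast
  have "matrix_inv cayley_mat ** (cayley_mat ** ?B) = ?B"
    unfolding matrix_mul_assoc using someI_ex[OF inv[unfolded invertible_def]]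
    by (simp add: matrix_inv_def)
  then show ?thesis by (simp only: 1 matrix_mul_rid)
qed

lemma cayley_conj_block:
  fixes A :: "complex ^ 'k ^ 'k::finite"
  shows "matrix_inv cayley_mat ** block_mat A B C D ** cayley_mat =
    block_mat (\<chi> i j. ((A $ i $ j + D $ i $ j) + \<i> * (B $ i $ j - C $ i $ j)) / 2)
              (\<chi> i j. ((A $ i $ j - D $ i $ j) - \<i> * (B $ i $ j + C $ i $ j)) / 2)
              (\<chi> i j. ((A $ i $ j - D $ i $ j) + \<i> * (B $ i $ j + C $ i $ j)) / 2)
              (\<chi> i j. ((A $ i $ j + D $ i $ j) - \<i> * (B $ i $ j - C $ i $ j)) / 2)"
  unfolding matrix_inv_cayley unfolding cayley_mat_alt Let_def block_mat_mult mat_mult_left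
  by (simp add: mat_mult_right vec_eq_iff block_mat_def sqrt2_sq field_simps split: sum.splits)

lemma of_real_block_mat:
  "of_real_mat (block_mat A B C D) =
   block_mat (of_real_mat A) (of_real_mat B) (of_real_mat C) (of_real_mat D)"
  by (auto simp: vec_eq_iff block_mat_def split: sum.splits)

text \<open>The matrices \<open>(P, Q; cnj Q, cnj P)\<close> are the conjugates of the symplectic matrices by
  \<open>(1, 1; i, -i) / sqrt 2\<close>, and \<open>\<xi> = (l + i \<mu>) / 2\<close>.\<close>

lemma jacobi_star_coordinates:
  fixes M :: "real ^ ('n::finite + 'n) ^ ('n + 'n)" and l \<mu> :: "real ^ 'n ^ 'm::finite"
    and \<kappa> :: "real ^ 'm ^ 'm"
  defines "X \<equiv> matrix_inv cayley_mat ** of_real_mat (jacobi_embedding M (l, \<mu>, \<kappa>)) ** cayley_mat"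
  shows "matrix_inv cayley_mat ** of_real_mat M ** cayley_mat =
           block_mat (jacobi_P X) (jacobi_Q X) (cnj_mat (jacobi_Q X)) (cnj_mat (jacobi_P X))"
    and "jacobi_xi X = (\<chi> i j. (of_real (l $ i $ j) + \<i> * of_real (\<mu> $ i $ j)) / 2)"
    and "block21 (block12 X) = cnj_mat (jacobi_xi X)"
proof -
  have M: "matrix_inv cayley_mat ** of_real_mat M ** cayley_mat =
     matrix_inv cayley_mat ** block_mat (of_real_mat (block11 M)) (of_real_mat (block12 M))
        (of_real_mat (block21 M)) (of_real_mat (block22 M)) ** cayley_mat"
    by (simp flip: of_real_block_mat add: block_mat_blocks)
  have X: "X = matrix_inv cayley_mat ** of_real_mat (jacobi_embedding M (l, \<mu>, \<kappa>)) ** cayley_mat"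
    by (simp add: X_def)
  note X' = X[unfolded jacobi_embedding_def prod.case of_real_block_mat cayley_conj_block]
  show "matrix_inv cayley_mat ** of_real_mat M ** cayley_mat =
           block_mat (jacobi_P X) (jacobi_Q X) (cnj_mat (jacobi_Q X)) (cnj_mat (jacobi_P X))"
    unfolding M cayley_conj_block X'
    by (simp add: jacobi_P_def jacobi_Q_def vec_eq_iff block_mat_def block11_def block12_def split: sum.splits)
  show "jacobi_xi X = (\<chi> i j. (of_real (l $ i $ j) + \<i> * of_real (\<mu> $ i $ j)) / 2)"
    and "block21 (block12 X) = cnj_mat (jacobi_xi X)"
    unfolding X'
    by (simp_all add: jacobi_xi_def vec_eq_iff block_mat_def block21_def block12_def block11_def mat_def)
qed

end

theory Submission
  imports Defs
begin

text \<open>Write \<open>W' = cnj W\<close>, \<open>X = (1 - W W')\<^sup>-\<^sup>1\<close> and \<open>Y = (1 - W' W)\<^sup>-\<^sup>1\<close>. The last three summands of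
  the metric add up to the single term in which \<open>X W (cnj \<eta>)\<^sup>t \<eta> W' X\<close> stands in front of
  \<open>dW Y d(cnj W)\<close>, and completing the square then gives
  \<open>ds\<^sup>2 / 4 = tr (X dW Y d(cnj W)) + tr (cnj \<theta> X \<theta>\<^sup>t)\<close> with
  \<open>\<theta> = d\<eta> + (\<eta> W' - cnj \<eta>) X dW\<close>, a sum of two positive Hermitian forms.
  The group acts by \<open>dW \<mapsto> R\<^sup>t dW R\<close>, \<open>\<theta> \<mapsto> \<theta> R\<close> and
  \<open>X \<mapsto> (cnj L) X L\<^sup>t\<close>, where \<open>L = (cnj Q) W + cnj P\<close> and \<open>R = L\<^sup>-\<^sup>1\<close>,
  which leaves both summands unchanged.\<close>

section \<open>Complex matrices and Hermitian forms\<close>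

text \<open>The factors \<open>1 - W\<close> and \<open>1 - cnj W\<close> in the last three summands
  are remnants of the partial Cayley transform. The formulas of the action contain no such factors,
  so these have to be eliminated before invariance can be read off. The coframe \<theta> comes from
  a change of fibre coordinate: if \<eta> is written as \<open>s W + cnj s\<close>, then
  \<open>d\<eta> - s dW = ds W + d(cnj s)\<close>, and this is \<theta>. The form
  \<open>tr (X dW Y d(cnj W))\<close> involves two different positive matrices; its positivity is
  obtained from compactness of the unit sphere and an expansion of \<open>X\<close>, without square
  roots of \<open>X\<close> and \<open>Y\<close>.\<close>

lemma matrix_distribs:
  fixes A B :: "'a::ring_1 ^ 'n ^ 'm" and C D :: "'a ^ 'k ^ 'n"
  shows "(A + B) ** C = A ** C + B ** C" "A ** (C + D) = A ** C + A ** D"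
    "(A - B) ** C = A ** C - B ** C" "A ** (C - D) = A ** C - A ** D"
    "(- A) ** C = - (A ** C)" "A ** (- C) = - (A ** C)"
  by (simp_all add: vec_eq_iff matrix_matrix_mult_def algebra_simps sum.distrib
      sum_subtractf sum_negf)

lemma transpose_arith:
  "transpose (A + B) = transpose A + transpose B"
  "transpose (A' - B') = transpose A' - transpose B'"
  "transpose (- A') = - transpose A'"
  "transpose 0 = 0"
  by (simp_all add: vec_eq_iff transpose_def)

lemma cnj_mat_simps:
  "cnj_mat (A ** B) = cnj_mat A ** cnj_mat B"
  "cnj_mat (C + D) = cnj_mat C + cnj_mat D"
  "cnj_mat (C - D) = cnj_mat C - cnj_mat D"
  "cnj_mat (transpose C) = transpose (cnj_mat C)"
  "cnj_mat (cnj_mat C) = C"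
  "cnj_mat (mat 1) = mat 1"
  "cnj_mat 0 = 0"
  "cnj_mat (r *\<^sub>R C) = r *\<^sub>R cnj_mat C"
  by (simp_all add: vec_eq_iff matrix_matrix_mult_def transpose_def mat_def)

lemma trace_transpose: "trace (transpose A) = trace A"
  by (simp add: trace_def transpose_def)

lemma trace_cnj_mat: "trace (cnj_mat A) = cnj (trace A)"
  by (simp add: trace_def)

lemma matrix_inv_inverse:
  fixes A :: "'a::field ^ 'n ^ 'n"
  assumes "invertible A"
  shows "A ** matrix_inv A = mat 1" "matrix_inv A ** A = mat 1"
  using someI_ex[OF assms[unfolded invertible_def]] by (simp_all add: matrix_inv_def)

lemma matrix_inv_cancel:
  fixes A :: "'a::field ^ 'n ^ 'n"
  assumes "invertible A"
  shows "B ** A ** matrix_inv A = B" "B ** matrix_inv A ** A = B"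
  using matrix_inv_inverse[OF assms] by (simp_all flip: matrix_mul_assoc)

lemma matrix_inv_unique:
  fixes A :: "'a::field ^ 'n ^ 'n"
  assumes "A ** B = mat 1"
  shows "matrix_inv A = B"
proof -
  have "invertible A"
    using assms invertible_right_inverse by blast
  then have "matrix_inv A ** (A ** B) = B"
    by (simp add: matrix_mul_assoc matrix_inv_inverse)
  then show ?thesis
    using assms by simp
qed

lemma matrix_inv_transpose:
  fixes A :: "'a::field ^ 'n ^ 'n"
  assumes "invertible A"
  shows "matrix_inv (transpose A) = transpose (matrix_inv A)"
  by (rule matrix_inv_unique) (simp add: assms matrix_inv_inverse flip: matrix_transpose_mul)

lemma matrix_inv_cnj_mat:
  fixes A :: "complex ^ 'n ^ 'n"
  assumes "invertible A"
  shows "matrix_inv (cnj_mat A) = cnj_mat (matrix_inv A)"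
  by (rule matrix_inv_unique)
    (simp add: assms matrix_inv_inverse cnj_mat_simps(6) flip: cnj_mat_simps(1))

lemma invertible_cnj_mat:
  fixes A :: "complex ^ 'n ^ 'n"
  assumes "invertible A"
  shows "invertible (cnj_mat A)"
  using matrix_inv_inverse[OF assms] unfolding invertible_def
  by (metis cnj_mat_simps(1) cnj_mat_simps(6))

section \<open>Positive definite Hermitian matrices\<close>

definition cinner :: "complex ^ 'n \<Rightarrow> complex ^ 'n \<Rightarrow> complex"
  where "cinner x y = (\<Sum>i\<in>UNIV. cnj (x $ i) * y $ i)"

lemma cinner_add_right: "cinner x (y + z) = cinner x y + cinner x z"
  by (simp add: cinner_def algebra_simps sum.distrib)

lemma cinner_self: "cinner x x = of_real ((norm x)\<^sup>2)"
proof -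
  have "(norm x)\<^sup>2 = (\<Sum>i\<in>UNIV. (cmod (x $ i))\<^sup>2)"
    by (simp add: norm_vec_def L2_set_def sum_nonneg)
  then show ?thesis
    by (simp add: cinner_def complex_norm_square mult.commute del: of_real_power)
qed

lemma cinner_adjoint:
  "cinner x (transpose (cnj_mat B) *v y) = cinner (B *v x) y"
proof -
  have "cinner x (transpose (cnj_mat B) *v y)
      = (\<Sum>i\<in>UNIV. \<Sum>j\<in>UNIV. cnj (x $ i) * (cnj (B $ j $ i) * y $ j))"
    by (simp add: cinner_def matrix_vector_mult_def transpose_def sum_distrib_left
        del: transpose_matrix_vector)
  also have "\<dots> = (\<Sum>j\<in>UNIV. \<Sum>i\<in>UNIV. cnj (x $ i) * (cnj (B $ j $ i) * y $ j))"
    by (rule sum.swap)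
  also have "\<dots> = cinner (B *v x) y"
    by (simp add: cinner_def matrix_vector_mult_def sum_distrib_left sum_distrib_right mult_ac)
  finally show ?thesis .
qed

lemma hermitian_pos_def_cinner:
  "hermitian_pos_def A \<longleftrightarrow>
    transpose (cnj_mat A) = A \<and> (\<forall>x. x \<noteq> 0 \<longrightarrow> 0 < Re (cinner x (A *v x)))"
  by (simp add: hermitian_pos_def_def cinner_def)

lemma invertible_if_kernel_trivial:
  fixes A :: "'a::field ^ 'n ^ 'n"
  assumes "\<And>x. A *v x = 0 \<Longrightarrow> x = 0"
  shows "invertible A"
  using assms by (auto simp: invertible_left_inverse matrix_left_invertible_ker)

lemma hermitian_pos_def_invertible:
  fixes A :: "complex ^ 'n ^ 'n"
  assumes "hermitian_pos_def A"
  shows "invertible A"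
proof (rule invertible_if_kernel_trivial)
  fix x assume "A *v x = 0"
  then have "Re (cinner x (A *v x)) = 0"
    by (simp add: cinner_def)
  then show "x = 0"
    using assms unfolding hermitian_pos_def_cinner by force
qed

lemma hermitian_pos_def_congruence:
  fixes A B :: "complex ^ 'n ^ 'n"
  assumes "hermitian_pos_def A" "invertible B"
  shows "hermitian_pos_def (transpose (cnj_mat B) ** A ** B)"
  unfolding hermitian_pos_def_cinner
proof (intro conjI allI impI)
  show "transpose (cnj_mat (transpose (cnj_mat B) ** A ** B)) = transpose (cnj_mat B) ** A ** B"
    using assms by (simp add: hermitian_pos_def_def cnj_mat_simps matrix_transpose_mul matrix_mul_assoc)
  fix x :: "complex ^ 'n"
  assume "x \<noteq> 0"
  then have "B *v x \<noteq> 0"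
    using assms(2) by (metis invertible_left_inverse matrix_left_invertible_ker)
  then show "0 < Re (cinner x (transpose (cnj_mat B) ** A ** B *v x))"
    using assms(1)
    by (simp add: hermitian_pos_def_cinner cinner_adjoint flip: matrix_vector_mul_assoc
        del: transpose_matrix_vector)
qed

text \<open>Serves to show that the denominator of the group action is invertible: its Gram matrix
  is a positive definite matrix plus another Gram matrix.\<close>

lemma hermitian_pos_def_add_gram:
  fixes A :: "complex ^ 'n ^ 'n" and N :: "complex ^ 'n ^ 'm"
  assumes "hermitian_pos_def A"
  shows "hermitian_pos_def (A + transpose (cnj_mat N) ** N)"
  unfolding hermitian_pos_def_cinner
proof (intro conjI allI impI)
  show "transpose (cnj_mat (A + transpose (cnj_mat N) ** N)) = A + transpose (cnj_mat N) ** N"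
    using assms by (simp add: hermitian_pos_def_def cnj_mat_simps matrix_transpose_mul transpose_arith)
  fix x :: "complex ^ 'n"
  assume "x \<noteq> 0"
  then have "0 < Re (cinner x (A *v x))"
    using assms by (simp add: hermitian_pos_def_cinner)
  moreover have "cinner x (transpose (cnj_mat N) ** N *v x) = of_real ((norm (N *v x))\<^sup>2)"
    by (simp add: cinner_adjoint cinner_self flip: matrix_vector_mul_assoc
        del: transpose_matrix_vector)
  ultimately show "0 < Re (cinner x ((A + transpose (cnj_mat N) ** N) *v x))"
    by (simp add: matrix_vector_mult_add_rdistrib cinner_add_right add_pos_nonneg)
qed

lemma hermitian_pos_def_cnj:
  fixes A :: "complex ^ 'n ^ 'n"
  assumes "hermitian_pos_def A"
  shows "hermitian_pos_def (cnj_mat A)"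
  unfolding hermitian_pos_def_cinner
proof (intro conjI allI impI)
  have *: "transpose (cnj_mat A) = A"
    using assms by (simp add: hermitian_pos_def_def)
  show "transpose (cnj_mat (cnj_mat A)) = cnj_mat A"
    by (subst (2) *[symmetric]) (simp add: cnj_mat_simps)
  fix x :: "complex ^ 'n"
  define y where "y = (\<chi> i. cnj (x $ i))"
  assume "x \<noteq> 0"
  then have "y \<noteq> 0"
    by (auto simp: y_def vec_eq_iff)
  then have "0 < Re (cinner y (A *v y))"
    using assms by (simp add: hermitian_pos_def_cinner)
  moreover have "cinner x (cnj_mat A *v x) = cnj (cinner y (A *v y))"
    by (simp add: cinner_def y_def matrix_vector_mult_def)
  ultimately show "0 < Re (cinner x (cnj_mat A *v x))"
    by simp
qed

text \<open>The inverse of a Hermitian matrix is Hermitian, hence congruent to the matrix itself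
  through the inverse.\<close>

lemma hermitian_pos_def_inverse:
  fixes A :: "complex ^ 'n ^ 'n"
  assumes "hermitian_pos_def A"
  shows "hermitian_pos_def (matrix_inv A)"
proof -
  have inv: "invertible A"
    using assms by (rule hermitian_pos_def_invertible)
  have herm: "transpose (cnj_mat A) = A"
    using assms by (simp add: hermitian_pos_def_def)
  have "transpose (cnj_mat (matrix_inv A)) = matrix_inv A"
    using herm inv by (metis invertible_cnj_mat matrix_inv_cnj_mat matrix_inv_transpose)
  then have "transpose (cnj_mat (matrix_inv A)) ** A ** matrix_inv A = matrix_inv A"
    using inv by (simp add: matrix_inv_inverse)
  moreover have "invertible (matrix_inv A)"
    using inv matrix_inv_inverse unfolding invertible_def by blast
  ultimately show ?thesis
    using hermitian_pos_def_congruence[OF assms, of "matrix_inv A"] by simp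
qed

text \<open>The trace is the sum of the values of the form at the columns of \<open>V\<close>, and a
  nonzero \<open>V\<close> has a nonzero column.\<close>

lemma trace_gram_pos:
  fixes A :: "complex ^ 'n ^ 'n" and V :: "complex ^ 'k ^ 'n"
  assumes "hermitian_pos_def A" "V \<noteq> 0"
  shows "0 < Re (trace (transpose (cnj_mat V) ** A ** V))"
proof -
  have eq: "trace (transpose (cnj_mat V) ** A ** V)
      = (\<Sum>k\<in>UNIV. cinner (column k V) (A *v column k V))"
    unfolding matrix_mul_assoc[symmetric]
    by (simp add: trace_def cinner_def column_def matrix_matrix_mult_def matrix_vector_mult_def
        transpose_def)
  obtain k where k: "column k V \<noteq> 0"
    using assms(2) by (auto simp: vec_eq_iff column_def)
  have nonneg: "0 \<le> Re (cinner x (A *v x))" for x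
    using assms(1) by (cases "x = 0") (auto simp: hermitian_pos_def_cinner cinner_def less_imp_le)
  have "0 < Re (cinner (column k V) (A *v column k V))"
    using assms(1) k by (simp add: hermitian_pos_def_cinner)
  then show ?thesis
    unfolding eq Re_sum using nonneg by (intro sum_pos2[of _ k]) auto
qed

lemma trace_gram_nonneg:
  fixes A :: "complex ^ 'n ^ 'n" and V :: "complex ^ 'k ^ 'n"
  assumes "hermitian_pos_def A"
  shows "0 \<le> Re (trace (transpose (cnj_mat V) ** A ** V))"
  using trace_gram_pos[OF assms, of V] by (cases "V = 0") (auto simp: trace_def)

text \<open>The norm of nested vectors is the Frobenius norm, so norm estimates for matrices become
  statements on traces of Gram matrices.\<close>

lemma norm_matrix_trace:
  fixes V :: "complex ^ 'k ^ 'n"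
  shows "(norm V)\<^sup>2 = Re (trace (transpose (cnj_mat V) ** V))"
proof -
  have "(norm V)\<^sup>2 = (\<Sum>i\<in>UNIV. \<Sum>j\<in>UNIV. (cmod (V $ i $ j))\<^sup>2)"
    by (simp add: norm_vec_def L2_set_def sum_nonneg)
  also have "\<dots> = (\<Sum>j\<in>UNIV. \<Sum>i\<in>UNIV. (cmod (V $ i $ j))\<^sup>2)"
    by (rule sum.swap)
  also have "\<dots> = Re (trace (transpose (cnj_mat V) ** V))"
    by (simp add: trace_def matrix_matrix_mult_def transpose_def cmod_power2 flip: power2_eq_square)
  finally show ?thesis .
qed

section \<open>Smooth matrix-valued functions\<close>

lemma Ck_on_SucD: "Ck_on (Suc k) f U \<Longrightarrow> Ck_on k f U"
proof (induction k arbitrary: f)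
  case 0
  then show ?case
    by (auto intro!: differentiable_imp_continuous_on differentiable_at_imp_differentiable_on)
qed auto

text \<open>Since \<open>U\<close> is open, derivatives at its points depend only on values in
  \<open>U\<close>, so the induction passes from \<open>f\<close> to \<open>g\<close>.\<close>

lemma Ck_on_cong:
  assumes "open U" "Ck_on k f U" "\<And>x. x \<in> U \<Longrightarrow> f x = g x"
  shows "Ck_on k g U"
  using assms(2,3)
proof (induction k arbitrary: f g)
  case 0
  then show ?case
    using continuous_on_cong by fastforce
next
  case (Suc k)
  have g: "(g has_derivative frechet_derivative f (at x)) (at x)" if "x \<in> U" for x
    using has_derivative_transform_within_open[OF _ assms(1)] Suc.prems that
    by (metis Ck_on.simps(2) frechet_derivative_works)
  have "Ck_on k (\<lambda>x. frechet_derivative g (at x) v) U" for v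
    by (rule Suc.IH[of "\<lambda>x. frechet_derivative f (at x) v"])
      (use Suc.prems(1) frechet_derivative_at[OF g] in auto)
  then show ?case
    using g by (auto simp: differentiable_def)
qed

text \<open>Replaces the chosen \<open>frechet_derivative\<close> by an explicit formula, so that
  each closure property follows from its differentiation rule by induction on the order.\<close>

lemma Ck_on_has_derivative:
  assumes "open U" and f': "\<And>x. x \<in> U \<Longrightarrow> (f has_derivative f' x) (at x)"
    and "\<And>v. Ck_on k (\<lambda>x. f' x v) U"
  shows "Ck_on (Suc k) f U"
proof -
  have "Ck_on k (\<lambda>x. frechet_derivative f (at x) v) U" for v
    by (rule Ck_on_cong[OF assms(1,3)]) (simp add: frechet_derivative_at[OF f', symmetric])
  then show ?thesis
    using f' by (auto simp: differentiable_def)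
qed

lemma Ck_on_frechet:
  assumes "Ck_on (Suc k) f U" "x \<in> U"
  shows "(f has_derivative frechet_derivative f (at x)) (at x)"
  using assms by (simp add: frechet_derivative_works)

lemma Ck_on_const: "open U \<Longrightarrow> Ck_on k (\<lambda>x. c) U"
  by (induction k arbitrary: c) (auto intro: Ck_on_cong)

lemma Ck_on_ident: "open U \<Longrightarrow> Ck_on k (\<lambda>x. x) U"
  by (cases k) (auto intro: Ck_on_const)

lemma Ck_on_add:
  assumes "open U" "Ck_on k f U" "Ck_on k g U"
  shows "Ck_on k (\<lambda>x. f x + g x) U"
  using assms(2,3)
proof (induction k arbitrary: f g)
  case (Suc k)
  show ?case
    by (rule Ck_on_has_derivative[OF assms(1) has_derivative_add])
      (use Suc in \<open>auto intro!: Ck_on_frechet\<close>)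
qed (simp add: continuous_on_add)

lemma Ck_on_linear:
  assumes "bounded_linear L" "open U" "Ck_on k f U"
  shows "Ck_on k (\<lambda>x. L (f x)) U"
  using assms(3)
proof (induction k arbitrary: f)
  case 0
  then show ?case
    by (simp add: bounded_linear.continuous_on[OF assms(1)])
next
  case (Suc k)
  show ?case
    by (rule Ck_on_has_derivative[OF assms(2) bounded_linear.has_derivative[OF assms(1)]])
      (use Suc in \<open>auto intro!: Ck_on_frechet\<close>)
qed

lemma Ck_on_diff:
  assumes "open U" "Ck_on k f U" "Ck_on k g U"
  shows "Ck_on k (\<lambda>x. f x - g x) U"
  using Ck_on_add[OF assms(1,2) Ck_on_linear[OF bounded_linear_minus[OF bounded_linear_ident] assms(1,3)]]
  by simp

lemma Ck_on_bilinear: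
  assumes "bounded_bilinear B" "open U" "Ck_on k f U" "Ck_on k g U"
  shows "Ck_on k (\<lambda>x. B (f x) (g x)) U"
  using assms(3,4)
proof (induction k arbitrary: f g)
  case 0
  then show ?case
    by (simp add: bounded_bilinear.continuous_on[OF assms(1)])
next
  case (Suc k)
  \<comment> \<open>The product rule pairs each function with the derivative of the other, so the
    functions themselves must be lowered to order \<open>k\<close>.\<close>
  note fg = Suc.prems[THEN Ck_on_SucD]
  show ?case
  proof (rule Ck_on_has_derivative[OF assms(2) bounded_bilinear.FDERIV[OF assms(1)]])
    fix v
    show "Ck_on k (\<lambda>x. B (f x) (frechet_derivative g (at x) v)
        + B (frechet_derivative f (at x) v) (g x)) U"
      using Suc fg by (intro Ck_on_add assms(2) Suc.IH) auto
  qed (use Suc in \<open>auto intro!: Ck_on_frechet\<close>)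
qed

lemma Ck_on_sum:
  assumes "open U" "\<And>i. i \<in> I \<Longrightarrow> Ck_on k (f i) U"
  shows "Ck_on k (\<lambda>x. \<Sum>i\<in>I. f i x) U"
proof (cases "finite I")
  case True
  then show ?thesis
    using assms(2) by induction (auto intro: Ck_on_const Ck_on_add assms(1))
qed (simp add: Ck_on_const assms(1))

lemma Ck_on_prod:
  fixes f :: "'i \<Rightarrow> 'a::real_normed_vector \<Rightarrow> 'b::{real_normed_algebra_1,comm_ring_1}"
  assumes "open U" "\<And>i. i \<in> I \<Longrightarrow> Ck_on k (f i) U"
  shows "Ck_on k (\<lambda>x. \<Prod>i\<in>I. f i x) U"
proof (cases "finite I")
  case True
  then show ?thesis
    using assms(2)
    by induction (auto intro: Ck_on_const Ck_on_bilinear[OF bounded_bilinear_mult] assms(1))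
qed (simp add: Ck_on_const assms(1))

lemma Ck_on_inverse:
  fixes f :: "'a::real_normed_vector \<Rightarrow> 'b::real_normed_div_algebra"
  assumes "open U" "Ck_on k f U" "\<And>x. x \<in> U \<Longrightarrow> f x \<noteq> 0"
  shows "Ck_on k (\<lambda>x. inverse (f x)) U"
  using assms(2)
proof (induction k)
  case 0
  then show ?case
    using assms(3) by (simp add: continuous_on_inverse)
next
  case (Suc k)
  \<comment> \<open>The derivative of the reciprocal contains the reciprocal again, which is covered
    at order \<open>k\<close> by induction.\<close>
  note IH = Suc.IH[OF Ck_on_SucD[OF Suc.prems]]
  show ?case
  proof (rule Ck_on_has_derivative[OF assms(1) Deriv.has_derivative_inverse])
    fix v
    show "Ck_on k (\<lambda>x. - (inverse (f x) * frechet_derivative f (at x) v * inverse (f x))) U"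
      using Suc.prems IH
      by (intro Ck_on_linear[OF bounded_linear_minus[OF bounded_linear_ident]] assms(1)
          Ck_on_bilinear[OF bounded_bilinear_mult]) auto
  qed (use assms(3) Suc.prems in \<open>auto intro!: Ck_on_frechet\<close>)
qed

section \<open>Smoothness of determinants and inverse matrices\<close>

lemma bounded_linear_axis: "bounded_linear (axis i :: 'b::euclidean_space \<Rightarrow> 'b ^ 'n)"
  by (intro linear_conv_bounded_linear[THEN iffD1] linearI)
    (auto simp: axis_def vec_eq_iff)

lemma Ck_on_vec:
  fixes f :: "'a::real_normed_vector \<Rightarrow> 'b::euclidean_space ^ 'n"
  assumes "open U" "\<And>i. Ck_on k (\<lambda>x. f x $ i) U"
  shows "Ck_on k f U"
proof (rule Ck_on_cong[OF assms(1)])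
  show "Ck_on k (\<lambda>x. \<Sum>i\<in>UNIV. axis i (f x $ i)) U"
    by (intro Ck_on_sum Ck_on_linear[OF bounded_linear_axis] assms)
  show "(\<Sum>i\<in>UNIV. axis i (f x $ i)) = f x" for x
    by (simp add: vec_eq_iff axis_def if_distrib cong: if_cong)
qed

lemma Ck_on_entry:
  "open U \<Longrightarrow> Ck_on k f U \<Longrightarrow> Ck_on k (\<lambda>x. f x $ i $ j) U"
  by (rule Ck_on_linear[where L = "\<lambda>A. A $ i $ j"])
    (auto intro: bounded_linear_compose[OF bounded_linear_vec_nth bounded_linear_vec_nth])

lemma Ck_on_matrix:
  fixes f :: "'a::real_normed_vector \<Rightarrow> 'b::euclidean_space ^ 'n ^ 'm"
  assumes "open U" "\<And>i j. Ck_on k (\<lambda>x. f x $ i $ j) U"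
  shows "Ck_on k f U"
  by (intro Ck_on_vec assms)

lemma Ck_on_det:
  fixes f :: "'a::real_normed_vector \<Rightarrow> complex ^ 'n ^ 'n"
  assumes "open U" "Ck_on k f U"
  shows "Ck_on k (\<lambda>x. det (f x)) U"
  unfolding det_def
  by (intro Ck_on_sum Ck_on_prod Ck_on_bilinear[OF bounded_bilinear_mult] Ck_on_const Ck_on_entry assms)

text \<open>Cramer's rule for the columns of the inverse. It reduces the smoothness of matrix
  inversion to that of determinants and of a scalar reciprocal.\<close>

lemma matrix_inv_cramer:
  fixes A :: "'a::field ^ 'n ^ 'n"
  assumes "invertible A"
  shows "matrix_inv A $ k $ l
    = det (\<chi> i j. if j = k then mat 1 $ i $ l else A $ i $ j) * inverse (det A)"
proof -
  have "A *v column l (matrix_inv A) = column l (mat 1)"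
  proof -
    have "A *v column l (matrix_inv A) = column l (A ** matrix_inv A)"
      by (simp add: vec_eq_iff column_def matrix_vector_mult_def matrix_matrix_mult_def)
    then show ?thesis
      by (simp add: assms matrix_inv_inverse)
  qed
  then have "column l (matrix_inv A) =
      (\<chi> k. det (\<chi> i j. if j = k then column l (mat 1) $ i else A $ i $ j) / det A)"
    using assms by (simp add: cramer invertible_det_nz)
  then show ?thesis
    by (simp add: vec_eq_iff column_def divide_inverse cong: if_cong)
qed

lemma Ck_on_matrix_inv:
  fixes f :: "'a::real_normed_vector \<Rightarrow> complex ^ 'n ^ 'n"
  assumes "open U" "Ck_on k f U" "\<And>x. x \<in> U \<Longrightarrow> invertible (f x)"
  shows "Ck_on k (\<lambda>x. matrix_inv (f x)) U"
proof (rule Ck_on_matrix[OF assms(1)])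
  fix a b
  have "Ck_on k (\<lambda>x. (\<chi> i j. if j = a then mat 1 $ i $ b else f x $ i $ j) :: complex ^ 'n ^ 'n) U"
  proof (rule Ck_on_matrix[OF assms(1)])
    show "Ck_on k (\<lambda>x. (\<chi> i j. if j = a then mat 1 $ i $ b else f x $ i $ j) $ i $ j) U" for i j
      by (cases "j = a") (simp_all add: Ck_on_const Ck_on_entry assms)
  qed
  then have "Ck_on k (\<lambda>x. det (\<chi> i j. if j = a then mat 1 $ i $ b else f x $ i $ j)
      * inverse (det (f x))) U"
    using assms(3)
    by (intro Ck_on_bilinear[OF bounded_bilinear_mult] Ck_on_inverse Ck_on_det assms(1,2))
      (auto simp: invertible_det_nz)
  then show "Ck_on k (\<lambda>x. matrix_inv (f x) $ a $ b) U"
    by (rule Ck_on_cong[OF assms(1)]) (simp add: matrix_inv_cramer assms(3))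
qed

lemma bounded_bilinear_matrix_mult:
  "bounded_bilinear ((**) :: complex ^ 'n ^ 'm \<Rightarrow> complex ^ 'k ^ 'n \<Rightarrow> complex ^ 'k ^ 'm)"
  unfolding bilinear_conv_bounded_bilinear[symmetric] bilinear_def
  by (auto intro!: linearI simp: matrix_distribs matrix_scalar_ac simp flip: scalar_matrix_assoc)

lemma bounded_linear_cnj_mat: "bounded_linear (cnj_mat :: complex ^ 'n ^ 'm \<Rightarrow> _)"
  by (intro linear_conv_bounded_linear[THEN iffD1] linearI) (simp_all add: cnj_mat_simps)

lemma bounded_linear_transpose: "bounded_linear (transpose :: complex ^ 'n ^ 'm \<Rightarrow> _)"
  by (intro linear_conv_bounded_linear[THEN iffD1] linearI) (simp_all add: transpose_arith transpose_scalar)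

lemma trace_scaleR:
  fixes A :: "complex ^ 'n ^ 'n"
  shows "trace (c *\<^sub>R A) = c *\<^sub>R trace A"
  by (simp add: trace_def scaleR_sum_right)

lemma bounded_linear_trace: "bounded_linear (trace :: complex ^ 'n ^ 'n \<Rightarrow> _)"
  by (intro linear_conv_bounded_linear[THEN iffD1] linearI) (simp_all add: trace_add trace_scaleR)

text \<open>Smoothness of inversion supplies some derivative \<open>D\<close>; differentiating
  \<open>B ** matrix_inv B = mat 1\<close> on the open set of invertible matrices then determines
  it.\<close>

lemma has_derivative_matrix_inv:
  fixes f :: "'a::real_normed_vector \<Rightarrow> complex ^ 'n ^ 'n"
  assumes "(f has_derivative f') (at x within S)" "invertible (f x)"
  shows "((\<lambda>x. matrix_inv (f x)) has_derivative
    (\<lambda>v. - (matrix_inv (f x) ** f' v ** matrix_inv (f x)))) (at x within S)"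
proof -
  define A U where "A = f x" and "U = {B :: complex ^ 'n ^ 'n. det B \<noteq> 0}"
  have "Ck_on 0 (det :: complex ^ 'n ^ 'n \<Rightarrow> complex) UNIV"
    by (intro Ck_on_det Ck_on_ident open_UNIV)
  then have U: "open U"
    unfolding U_def by (intro open_Collect_neq continuous_on_const) simp
  have A: "A \<in> U"
    using assms(2) by (simp add: A_def U_def invertible_det_nz)
  have "Ck_on (Suc 0) matrix_inv U"
    by (intro Ck_on_matrix_inv Ck_on_ident U) (simp add: U_def invertible_det_nz)
  then have "matrix_inv differentiable (at A)"
    using A by simp
  then obtain D where D: "(matrix_inv has_derivative D) (at A)"
    unfolding differentiable_def by blast
  have "((\<lambda>B. B ** matrix_inv B) has_derivative (\<lambda>v. A ** D v + v ** matrix_inv A)) (at A)"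
    by (rule bounded_bilinear.FDERIV[OF bounded_bilinear_matrix_mult has_derivative_ident D])
  moreover have "((\<lambda>B. B ** matrix_inv B) has_derivative (\<lambda>v. 0)) (at A)"
    by (rule has_derivative_transform_within_open[OF has_derivative_const[of "mat 1"] U A])
      (simp add: U_def matrix_inv_inverse invertible_det_nz)
  ultimately have "(\<lambda>v. A ** D v + v ** matrix_inv A) = (\<lambda>v. 0)"
    by (rule has_derivative_unique)
  then have AD: "A ** D v = - (v ** matrix_inv A)" for v
    by (metis add_eq_0_iff2)
  have "D v = - (matrix_inv A ** v ** matrix_inv A)" for v
  proof -
    have "matrix_inv A ** (A ** D v) = - (matrix_inv A ** v ** matrix_inv A)"
      by (simp only: AD matrix_distribs matrix_mul_assoc)
    then show ?thesis
      using assms(2) by (simp add: A_def matrix_mul_assoc matrix_inv_inverse)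
  qed
  then have "D = (\<lambda>v. - (matrix_inv A ** v ** matrix_inv A))"
    by blast
  then show ?thesis
    using has_derivative_compose[OF assms(1), of matrix_inv D] D by (simp add: A_def)
qed

section \<open>The Hermitian form of the metric\<close>

text \<open>The last three summands of the metric collapse to a single one; this is a formal identity
  in which \<open>W\<close> and \<open>K\<close> need not be related.\<close>

lemma cayley_terms_collapse:
  fixes W K N :: "'a::field ^ 'n ^ 'n"
  assumes "invertible (mat 1 - K)" "invertible (mat 1 - W)"
    and "invertible (mat 1 - W ** K)" "invertible (mat 1 - K ** W)"
  defines "X \<equiv> matrix_inv (mat 1 - W ** K)" and "Y \<equiv> matrix_inv (mat 1 - K ** W)"
    and "a \<equiv> matrix_inv (mat 1 - K)" and "b \<equiv> matrix_inv (mat 1 - W)"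
  shows "W ** Y = X ** W" "Y ** K = K ** X"
    and "a ** N ** K ** X + a ** (mat 1 - W) ** Y ** N ** Y ** (mat 1 - K) ** b
      - X ** (mat 1 - W) ** a ** N ** b = X ** W ** N ** K ** X"
proof -
  note [simp] = matrix_mul_assoc matrix_distribs
  note inv = matrix_inv_inverse[OF assms(1)] matrix_inv_inverse[OF assms(2)]
    matrix_inv_inverse[OF assms(3)] matrix_inv_inverse[OF assms(4)]
  note invs = inv[folded X_def Y_def a_def b_def]
  have cancel: "C ** a ** (mat 1 - K) = C" "C ** (mat 1 - K) ** a = C"
    "C ** b ** (mat 1 - W) = C" "C ** (mat 1 - W) ** b = C" for C :: "'a ^ 'n ^ 'n"
    unfolding a_def b_def using assms(1,2) by (simp_all add: matrix_inv_cancel del: matrix_distribs)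
  have X1: "X - X ** W ** K = mat 1" and Y1: "Y - Y ** K ** W = mat 1"
    and X2: "X - W ** K ** X = mat 1" and Y2: "Y - K ** W ** Y = mat 1"
    using invs by simp_all
  show XW: "W ** Y = X ** W"
  proof -
    \<comment> \<open>The push-through identity: \<open>W - W K W\<close> has \<open>1 - W K\<close>
      as a left factor and \<open>1 - K W\<close> as a right factor, which cancel against
      \<open>X\<close> and \<open>Y\<close> respectively.\<close>
    have "X ** (W - W ** K ** W) ** Y = X ** W ** (Y - K ** W ** Y)"
      by simp
    moreover have "X ** (W - W ** K ** W) ** Y = (X - X ** W ** K) ** W ** Y"
      by simp
    ultimately show ?thesis
      using X1 Y2 by simp
  qed
  show KX: "Y ** K = K ** X"
  proof -
    have "Y ** (K - K ** W ** K) ** X = Y ** K ** (X - W ** K ** X)"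
      by simp
    moreover have "Y ** (K - K ** W ** K) ** X = (Y - Y ** K ** W) ** K ** X"
      by simp
    ultimately show ?thesis
      using Y1 X2 by simp
  qed
  \<comment> \<open>With \<open>X W = a - F\<close> and \<open>K X = b - G\<close> the three terms
    read \<open>a N (b - G) + F N G - F N b\<close>, which factors as
    \<open>(a - F) N (b - G)\<close>.\<close>
  define F G where "F = X ** (mat 1 - W) ** a" and "G = Y ** (mat 1 - K) ** b"
  have F1: "X ** W = a - F"
  proof -
    have "X ** W ** (mat 1 - K) = (a - F) ** (mat 1 - K)"
    proof -
      have "(a - F) ** (mat 1 - K) = mat 1 - X ** (mat 1 - W)"
        unfolding F_def using cancel(1)[of "mat 1"] cancel(1)[of "X ** (mat 1 - W)"]
        by (simp add: matrix_distribs(3)[of a] del: matrix_distribs)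
      also have "\<dots> = X ** W - X ** W ** K"
        using X1 by (simp add: algebra_simps)
      finally show ?thesis by simp
    qed
    then show ?thesis
      using cancel(2) by metis
  qed
  have G1: "K ** X = b - G"
  proof -
    have "K ** X ** (mat 1 - W) = (b - G) ** (mat 1 - W)"
    proof -
      have "(b - G) ** (mat 1 - W) = mat 1 - Y ** (mat 1 - K)"
        unfolding G_def using cancel(3)[of "mat 1"] cancel(3)[of "Y ** (mat 1 - K)"]
        by (simp add: matrix_distribs(3)[of b] del: matrix_distribs)
      also have "\<dots> = Y ** K - Y ** K ** W"
        using Y1 by (simp add: algebra_simps)
      finally show ?thesis by (simp add: KX)
    qed
    then show ?thesis
      using cancel(4) by metis
  qed
  have F2: "a ** (mat 1 - W) ** Y = F"
  proof -
    \<comment> \<open>By the push-through identities the expansions differ only in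
      \<open>X + K X W\<close> against \<open>Y + X W K\<close>; these agree because
      \<open>X - X W K\<close> and \<open>Y - K X W\<close> are both the identity.\<close>
    have "(mat 1 - K) ** X ** (mat 1 - W) = (mat 1 - W) ** Y ** (mat 1 - K)"
    proof -
      have "X + K ** X ** W = Y + X ** W ** K"
      proof -
        have "X - X ** W ** K = Y - K ** X ** W"
          using X1 Y1 by (simp only: KX[symmetric])
        then show ?thesis
          by (simp add: algebra_simps)
      qed
      then show ?thesis
        using KX XW by (simp add: algebra_simps)
    qed
    then have "a ** ((mat 1 - K) ** X ** (mat 1 - W)) ** a = a ** ((mat 1 - W) ** Y ** (mat 1 - K)) ** a"
      by (simp del: matrix_distribs)
    then show ?thesis
      unfolding F_def using invs cancel by (simp del: matrix_distribs)
  qed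
  have "a ** N ** K ** X + a ** (mat 1 - W) ** Y ** N ** Y ** (mat 1 - K) ** b
      - X ** (mat 1 - W) ** a ** N ** b = a ** N ** (K ** X) + F ** N ** G - F ** N ** b"
    using F2 by (simp add: F_def G_def del: matrix_distribs)
  also have "\<dots> = (X ** W) ** N ** (K ** X)"
    unfolding F1 G1 by (simp add: algebra_simps)
  finally show "a ** N ** K ** X + a ** (mat 1 - W) ** Y ** N ** Y ** (mat 1 - K) ** b
      - X ** (mat 1 - W) ** a ** N ** b = X ** W ** N ** K ** X"
    by simp
qed

definition disk_resolvent :: "complex ^ 'n ^ 'n \<Rightarrow> complex ^ 'n ^ 'n"
  where "disk_resolvent W = matrix_inv (mat 1 - W ** cnj_mat W)"

text \<open>The form \<theta> of the overview, evaluated at the tangent vector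
  \<open>u\<close>.\<close>

definition jacobi_coframe ::
  "('n::finite, 'm::finite) sj_space \<Rightarrow> ('n, 'm) sj_space \<Rightarrow> complex ^ 'n ^ 'm"
  where "jacobi_coframe p u = snd u +
    (snd p ** cnj_mat (fst p) - cnj_mat (snd p)) ** disk_resolvent (fst p) ** fst u"

text \<open>The first vector supplies the holomorphic differentials and the second the
  antiholomorphic ones; symmetrization is postponed.\<close>

definition jacobi_form ::
  "('n::finite, 'm::finite) sj_space \<Rightarrow> ('n, 'm) sj_space \<Rightarrow> ('n, 'm) sj_space \<Rightarrow> complex"
  where "jacobi_form p u v =
    trace (disk_resolvent (fst p) ** fst u ** disk_resolvent (cnj_mat (fst p)) ** cnj_mat (fst v))
    + trace (cnj_mat (jacobi_coframe p v) ** disk_resolvent (fst p) ** transpose (jacobi_coframe p u))"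

lemma disk_symmetric:
  "W \<in> generalized_unit_disk \<Longrightarrow> transpose W = W"
  "W \<in> generalized_unit_disk \<Longrightarrow> transpose (cnj_mat W) = cnj_mat W"
  by (auto simp: generalized_unit_disk_def simp flip: cnj_mat_simps(4))

lemma disk_cnj:
  assumes "W \<in> generalized_unit_disk"
  shows "cnj_mat W \<in> generalized_unit_disk"
  using assms hermitian_pos_def_cnj[of "mat 1 - cnj_mat W ** W"] disk_symmetric(2)[OF assms]
  by (simp add: generalized_unit_disk_def cnj_mat_simps)

lemma disk_pos:
  assumes "W \<in> generalized_unit_disk"
  shows "hermitian_pos_def (mat 1 - W ** cnj_mat W)"
  using disk_cnj[OF assms] by (simp add: generalized_unit_disk_def cnj_mat_simps)

lemma disk_invertible:
  assumes "W \<in> generalized_unit_disk"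
  shows "invertible (mat 1 - W ** cnj_mat W)"
  using disk_pos[OF assms] by (rule hermitian_pos_def_invertible)

lemma disk_resolvent_pos:
  assumes "W \<in> generalized_unit_disk"
  shows "hermitian_pos_def (disk_resolvent W)"
  unfolding disk_resolvent_def using disk_pos[OF assms] by (rule hermitian_pos_def_inverse)

lemma cnj_disk_resolvent:
  assumes "W \<in> generalized_unit_disk"
  shows "cnj_mat (disk_resolvent W) = disk_resolvent (cnj_mat W)"
  using matrix_inv_cnj_mat[OF disk_invertible[OF assms]]
  by (simp add: disk_resolvent_def cnj_mat_simps)

lemma transpose_disk_resolvent:
  assumes "W \<in> generalized_unit_disk"
  shows "transpose (disk_resolvent W) = disk_resolvent (cnj_mat W)"
  using matrix_inv_transpose[OF disk_invertible[OF assms]] disk_symmetric[OF assms]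
  by (simp add: disk_resolvent_def cnj_mat_simps transpose_arith matrix_transpose_mul)

text \<open>A nonzero vector fixed by \<open>W\<close> would be a zero of the positive definite form
  \<open>1 - (cnj W) W\<close>.\<close>

lemma disk_one_minus_invertible:
  assumes "W \<in> generalized_unit_disk"
  shows "invertible (mat 1 - W)"
proof (rule invertible_if_kernel_trivial)
  fix x assume "(mat 1 - W) *v x = 0"
  then have Wx: "W *v x = x"
    by (simp add: matrix_vector_mult_diff_rdistrib)
  have "cinner x (transpose (cnj_mat W) *v (W *v x)) = cinner x x"
    unfolding cinner_adjoint Wx ..
  then have "cinner x ((mat 1 - cnj_mat W ** W) *v x) = 0"
    using disk_symmetric(2)[OF assms]
    by (simp add: matrix_vector_mult_diff_rdistrib cinner_def algebra_simps sum_subtractf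
        flip: matrix_vector_mul_assoc)
  then show "x = 0"
    using assms by (auto simp: generalized_unit_disk_def hermitian_pos_def_cinner)
qed

lemma disk_resolvent_commute:
  assumes "W \<in> generalized_unit_disk"
  shows "W ** disk_resolvent (cnj_mat W) = disk_resolvent W ** W"
    "disk_resolvent (cnj_mat W) ** cnj_mat W = cnj_mat W ** disk_resolvent W"
  using cayley_terms_collapse(1,2)[of "cnj_mat W" W] disk_cnj[OF assms] assms
    disk_one_minus_invertible[of W] disk_one_minus_invertible[of "cnj_mat W"] disk_invertible[of W] disk_invertible[of "cnj_mat W"]
  by (simp_all add: disk_resolvent_def cnj_mat_simps)

text \<open>Expanding the product of \<theta> and its conjugate gives the \<open>d\<eta>\<close>
  term, the two mixed terms and a term quadratic in \<open>dW\<close>. The last one accounts for the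
  six summands with coefficients quadratic in \<eta>, once three of them are collapsed.\<close>

lemma quarter_ds2_eq_jacobi_form:
  fixes W U V :: "complex ^ 'n::finite ^ 'n" and \<eta> e f :: "complex ^ 'n ^ 'm::finite"
  assumes W: "W \<in> generalized_unit_disk" and U: "transpose U = U" and V: "transpose V = V"
  shows "quarter_ds2 W \<eta> U (cnj_mat V) e (cnj_mat f) = jacobi_form (W, \<eta>) (U, e) (V, f)"
proof -
  define W' \<eta>' X Y where "W' = cnj_mat W" and "\<eta>' = cnj_mat \<eta>"
    and "X = disk_resolvent W" and "Y = disk_resolvent W'"
  define Z f' where "Z = cnj_mat V" and "f' = cnj_mat f"
  \<comment> \<open>The two are conjugate, so \<open>e + a ** U\<close> and
    \<open>f' + b ** Z\<close> are a value of the coframe and a conjugated one.\<close>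
  define a b where "a = (\<eta> ** W' - \<eta>') ** X" and "b = (\<eta>' ** W - \<eta>) ** Y"
  have Z: "transpose Z = Z"
    using V by (simp add: Z_def flip: cnj_mat_simps(4))
  have XY: "transpose X = Y" "transpose Y = X" "cnj_mat X = Y"
    using W by (simp_all add: X_def Y_def W'_def transpose_disk_resolvent cnj_disk_resolvent
        disk_cnj cnj_mat_simps)
  have WW: "transpose W = W" "transpose W' = W'"
    using W by (simp_all add: W'_def disk_symmetric)
  have comm: "W ** Y = X ** W" "Y ** W' = W' ** X"
    using disk_resolvent_commute[OF W] by (simp_all add: X_def Y_def W'_def)
  define N D where "N = transpose \<eta>' ** \<eta>" and "D = U ** Y ** Z"
  have collapse: "matrix_inv (mat 1 - W') ** N ** W' ** X
      + matrix_inv (mat 1 - W') ** (mat 1 - W) ** Y ** N ** Y ** (mat 1 - W') ** matrix_inv (mat 1 - W)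
      - X ** (mat 1 - W) ** matrix_inv (mat 1 - W') ** N ** matrix_inv (mat 1 - W)
      = X ** W ** N ** W' ** X"
    using cayley_terms_collapse(3)[of W' W N] W disk_cnj[OF W] disk_one_minus_invertible[of W]
      disk_one_minus_invertible[of "cnj_mat W"]
      disk_invertible[of W] disk_invertible[of "cnj_mat W"]
    by (simp add: X_def Y_def W'_def disk_resolvent_def cnj_mat_simps)
  have b_t: "transpose b = X ** (W ** transpose \<eta>' - transpose \<eta>)"
    by (simp add: b_def matrix_transpose_mul transpose_arith XY WW)
  have "jacobi_form (W, \<eta>) (U, e) (V, f)
      = trace (X ** U ** Y ** Z) + trace ((f' + b ** Z) ** X ** transpose (e + a ** U))"
    by (simp add: jacobi_form_def jacobi_coframe_def a_def b_def X_def Y_def W'_def \<eta>'_def Z_def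
        f'_def cnj_mat_simps cnj_disk_resolvent W)
  also have "(f' + b ** Z) ** X ** transpose (e + a ** U)
      = f' ** X ** transpose e + f' ** X ** U ** transpose a + b ** Z ** X ** transpose e
        + b ** Z ** X ** U ** transpose a"
    by (simp add: matrix_distribs transpose_arith matrix_transpose_mul U matrix_mul_assoc)
  finally have form: "jacobi_form (W, \<eta>) (U, e) (V, f)
      = trace (X ** U ** Y ** Z) + trace (f' ** X ** transpose e)
        + trace (f' ** X ** U ** transpose a) + trace (b ** Z ** X ** transpose e)
        + trace (b ** Z ** X ** U ** transpose a)"
    by (simp add: trace_add)
  have t1: "trace (f' ** X ** transpose e) = trace (X ** transpose e ** f')"
    by (metis matrix_mul_assoc trace_mul_sym)
  \<comment> \<open>Transposition reverses the factors, exchanges \<open>X\<close> and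
    \<open>Y\<close>, and fixes the symmetric \<open>U\<close> and \<open>Z\<close>.\<close>
  have t2: "trace (f' ** X ** U ** transpose a) = trace (a ** U ** Y ** transpose f')"
    by (subst trace_transpose[symmetric]) (simp add: matrix_transpose_mul XY U matrix_mul_assoc)
  have t3: "trace (b ** Z ** X ** U ** transpose a) = trace (transpose b ** a ** D)"
  proof -
    have "trace (b ** Z ** X ** U ** transpose a) = trace (a ** D ** transpose b)"
      by (subst trace_transpose[symmetric])
        (simp add: matrix_transpose_mul XY U Z D_def matrix_mul_assoc)
    also have "\<dots> = trace (transpose b ** a ** D)"
      by (metis matrix_mul_assoc trace_mul_sym)
    finally show ?thesis .
  qed
  \<comment> \<open>This is \<open>X (W \<eta>'^t - \<eta>^t) (\<eta> W' - \<eta>') X\<close>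
    multiplied out; its first term is the collapsed one.\<close>
  have "transpose b ** a = X ** W ** N ** W' ** X - X ** W ** transpose \<eta>' ** \<eta>' ** X
      - X ** transpose \<eta> ** \<eta> ** W' ** X + X ** transpose \<eta> ** \<eta>' ** X"
    by (simp add: b_t a_def N_def matrix_distribs matrix_mul_assoc)
  then have t4: "trace (transpose b ** a ** D)
      = trace (X ** W ** N ** W' ** X ** D) - trace (X ** W ** transpose \<eta>' ** \<eta>' ** X ** D)
      - trace (X ** transpose \<eta> ** \<eta> ** W' ** X ** D) + trace (X ** transpose \<eta> ** \<eta>' ** X ** D)"
    by (simp add: matrix_distribs trace_add trace_sub)
  have t5: "trace (X ** W ** N ** W' ** X ** D) =
      trace (matrix_inv (mat 1 - W') ** N ** W' ** X ** D)
      + trace (matrix_inv (mat 1 - W') ** (mat 1 - W) ** Y ** N ** Y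
              ** (mat 1 - W') ** matrix_inv (mat 1 - W) ** D)
      - trace (X ** (mat 1 - W) ** matrix_inv (mat 1 - W') ** N ** matrix_inv (mat 1 - W) ** D)"
    unfolding collapse[symmetric]
    by (simp add: matrix_distribs(1)[of _ _ D] matrix_distribs(3)[of _ _ D] trace_add trace_sub)
  have t6: "X ** transpose \<eta> ** \<eta> ** W' ** X ** D = X ** transpose \<eta> ** \<eta> ** Y ** W' ** U ** Y ** Z"
    using comm(2) by (simp add: D_def flip: matrix_mul_assoc)
  have Xdef: "matrix_inv (mat 1 - W ** W') = X" and Ydef: "matrix_inv (mat 1 - W' ** W) = Y"
    by (simp_all add: X_def Y_def W'_def disk_resolvent_def cnj_mat_simps)
  show ?thesis
    unfolding form t1 t2 t3 t4 t5 t6 quarter_ds2_def Let_def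
    unfolding W'_def[symmetric] \<eta>'_def[symmetric] Z_def[symmetric] f'_def[symmetric] Xdef Ydef
    by (simp add: D_def N_def a_def b_def matrix_mul_assoc comm(1))
qed

text \<open>Conjugation exchanges \<open>X\<close> and \<open>Y\<close>; cyclicity of the trace
  restores the first summand, transposition the second.\<close>

lemma jacobi_form_hermitian:
  assumes "p \<in> siegel_jacobi_disk"
  shows "jacobi_form p v u = cnj (jacobi_form p u v)"
proof -
  obtain W \<eta> where p: "p = (W, \<eta>)" by fastforce
  then have W: "W \<in> generalized_unit_disk"
    using assms by (simp add: siegel_jacobi_disk_def)
  define X Y where "X = disk_resolvent W" and "Y = disk_resolvent (cnj_mat W)"
  have XY: "transpose Y = X" "cnj_mat X = Y" "cnj_mat Y = X"
    using W by (simp_all add: X_def Y_def transpose_disk_resolvent cnj_disk_resolvent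
        disk_cnj cnj_mat_simps)
  let ?s = "jacobi_coframe p u" and ?t = "jacobi_coframe p v"
  have "cnj (jacobi_form p u v) = trace (Y ** cnj_mat (fst u) ** X ** fst v)
      + trace (?t ** Y ** transpose (cnj_mat ?s))"
    by (simp add: jacobi_form_def p cnj_mat_simps XY flip: trace_cnj_mat X_def Y_def)
  also have "trace (Y ** cnj_mat (fst u) ** X ** fst v) = trace (X ** fst v ** Y ** cnj_mat (fst u))"
    by (metis matrix_mul_assoc trace_mul_sym)
  also have "trace (?t ** Y ** transpose (cnj_mat ?s)) = trace (cnj_mat ?s ** X ** transpose ?t)"
    by (subst trace_transpose[symmetric]) (simp add: matrix_transpose_mul XY matrix_mul_assoc)
  finally show ?thesis
    by (simp add: jacobi_form_def p X_def Y_def)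
qed

text \<open>The two orders in the symmetric product have conjugate values, so their sum is twice a
  real part. This gives reality of the metric and reduces the remaining claims to the Hermitian
  form.\<close>

lemma siegel_jacobi_ds2_eq:
  assumes "p \<in> siegel_jacobi_disk" "u \<in> siegel_jacobi_tangent" "v \<in> siegel_jacobi_tangent"
  shows "siegel_jacobi_ds2 p u v = of_real (4 * Re (jacobi_form p u v))"
proof -
  have "quarter_ds2 (fst p) (snd p) (fst a) (cnj_mat (fst b)) (snd a) (cnj_mat (snd b))
      = jacobi_form p a b" if "a \<in> siegel_jacobi_tangent" "b \<in> siegel_jacobi_tangent" for a b
    using quarter_ds2_eq_jacobi_form[of "fst p" "fst a" "fst b"] assms(1) that
    by (auto simp: siegel_jacobi_disk_def siegel_jacobi_tangent_def)
  then have "siegel_jacobi_ds2 p u v = 2 * (jacobi_form p u v + jacobi_form p v u)"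
    using assms by (simp add: siegel_jacobi_ds2_def)
  then show ?thesis
    using jacobi_form_hermitian[OF assms(1), of v u] by (simp add: complex_eq_iff)
qed

section \<open>Positivity of the Hermitian form\<close>

lemma disk_contraction:
  fixes V :: "complex ^ 'k ^ 'n"
  assumes "W \<in> generalized_unit_disk"
  shows "norm (W ** V) \<le> norm V"
proof -
  have "0 \<le> Re (trace (transpose (cnj_mat V) ** (mat 1 - cnj_mat W ** W) ** V))"
    using assms by (intro trace_gram_nonneg) (simp add: generalized_unit_disk_def)
  also have "\<dots> = (norm V)\<^sup>2 - (norm (W ** V))\<^sup>2"
    by (simp add: norm_matrix_trace matrix_distribs trace_sub cnj_mat_simps matrix_transpose_mul
        disk_symmetric[OF assms] matrix_mul_assoc)
  finally show ?thesis
    by (simp add: power2_le_iff_abs_le)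
qed

text \<open>At a minimum point \<open>V\<close> of the form on the unit sphere, the expansion
  \<open>X = 1 + H + H X H\<close> with the contraction \<open>H = W (cnj W)\<close> bounds the form at \<open>V\<close> strictly
  below by its value at \<open>H V\<close>, so that the minimum cannot be nonpositive.\<close>

lemma disk_trace_pos:
  fixes W V :: "complex ^ 'n::finite ^ 'n"
  assumes W: "W \<in> generalized_unit_disk" and "V \<noteq> 0"
  shows "0 < Re (trace (disk_resolvent W ** V ** disk_resolvent (cnj_mat W) ** transpose (cnj_mat V)))"
proof -
  define X Y where "X = disk_resolvent W" and "Y = disk_resolvent (cnj_mat W)"
  define q where "q V = Re (trace (X ** V ** Y ** transpose (cnj_mat V)))" for V
  define H where "H = W ** cnj_mat W"
  have Hadj: "transpose (cnj_mat H) = H"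
    by (simp add: H_def cnj_mat_simps matrix_transpose_mul disk_symmetric[OF W])
  have X: "X = mat 1 + H + H ** X ** H"
  proof -
    have inv: "(mat 1 - H) ** X = mat 1" "X ** (mat 1 - H) = mat 1"
      using matrix_inv_inverse[OF disk_invertible[OF W]]
      by (simp_all add: X_def H_def disk_resolvent_def)
    then have X1: "X = mat 1 + X ** H" and "X = mat 1 + H ** X"
      by (simp_all add: matrix_distribs algebra_simps)
    have "H ** X = H ** (mat 1 + X ** H)"
      using X1 by simp
    then show ?thesis
      using \<open>X = mat 1 + H ** X\<close> by (simp add: matrix_distribs matrix_mul_assoc add.assoc)
  qed
  have Ypos: "hermitian_pos_def Y"
    unfolding Y_def by (intro disk_resolvent_pos disk_cnj W)
  have Ytr: "0 \<le> Re (trace (U ** Y ** transpose (cnj_mat U)))"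
    "U \<noteq> 0 \<Longrightarrow> 0 < Re (trace (U ** Y ** transpose (cnj_mat U)))" for U :: "complex ^ 'n ^ 'n"
  proof -
    have *: "transpose (cnj_mat (transpose (cnj_mat U))) = U"
      by (simp add: cnj_mat_simps)
    show "0 \<le> Re (trace (U ** Y ** transpose (cnj_mat U)))"
      using trace_gram_nonneg[OF Ypos, of "transpose (cnj_mat U)"] by (simp only: *)
    assume "U \<noteq> 0"
    then have "transpose (cnj_mat U) \<noteq> 0"
      using * by (metis cnj_mat_simps(7) transpose_arith(4))
    then show "0 < Re (trace (U ** Y ** transpose (cnj_mat U)))"
      using trace_gram_pos[OF Ypos, of "transpose (cnj_mat U)"] unfolding * by blast
  qed
  \<comment> \<open>The summands \<open>1\<close>, \<open>H\<close> and \<open>H X H\<close> of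
    \<open>X\<close> contribute separately: \<open>H\<close> gives the \<open>Y\<close> form at
    \<open>(cnj W) U\<close>, which is nonnegative, and \<open>H X H\<close> gives
    \<open>q (H ** U)\<close> by cyclicity.\<close>
  have q_step: "q U \<ge> Re (trace (U ** Y ** transpose (cnj_mat U))) + q (H ** U)" for U
  proof -
    let ?P = "U ** Y ** transpose (cnj_mat U)" and ?U = "cnj_mat W ** U"
    have "X ** ?P = ?P + H ** ?P + H ** X ** H ** ?P"
      by (subst X) (simp add: matrix_distribs)
    then have "q U = Re (trace ?P) + Re (trace (H ** ?P)) + Re (trace (H ** X ** H ** ?P))"
      by (simp add: q_def matrix_mul_assoc trace_add)
    also have "trace (H ** ?P) = trace (?U ** Y ** transpose (cnj_mat ?U))"
      unfolding H_def
      using trace_mul_sym[of W "cnj_mat W ** ?P"]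
      by (simp add: cnj_mat_simps matrix_transpose_mul disk_symmetric[OF W] matrix_mul_assoc)
    also have "trace (H ** X ** H ** ?P) = trace (X ** (H ** U) ** Y ** transpose (cnj_mat (H ** U)))"
      unfolding cnj_mat_simps(1) matrix_transpose_mul Hadj
      using trace_mul_sym[of H "X ** H ** ?P"] by (simp add: matrix_mul_assoc)
    finally show ?thesis
      using Ytr(1)[of ?U] by (simp add: q_def)
  qed
  have q_scale: "q (c *\<^sub>R U) = c\<^sup>2 * q U" for c U
    by (simp add: q_def cnj_mat_simps transpose_scalar matrix_scalar_ac power2_eq_square
        trace_scaleR flip: scalar_matrix_assoc)
  have "continuous_on (sphere 0 1) q"
    unfolding q_def
    by (intro continuous_intros bounded_linear.continuous_on[OF bounded_linear_trace]
        bounded_bilinear.continuous_on[OF bounded_bilinear_matrix_mult]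
        bounded_linear.continuous_on[OF bounded_linear_transpose]
        bounded_linear.continuous_on[OF bounded_linear_cnj_mat])
  moreover have sphere: "(1 / norm U) *\<^sub>R U \<in> sphere 0 1" if "U \<noteq> 0" for U :: "complex ^ 'n ^ 'n"
    using that by simp
  ultimately obtain V0 where V0: "V0 \<in> sphere 0 1" "\<And>U. U \<in> sphere 0 1 \<Longrightarrow> q V0 \<le> q U"
    using continuous_attains_inf[of "sphere 0 1" q] \<open>V \<noteq> 0\<close> by (metis compact_sphere empty_iff)
  have q_ge: "(norm U)\<^sup>2 * q V0 \<le> q U" for U
  proof (cases "U = 0")
    case True
    then show ?thesis
      using q_scale[of 0 U] by simp
  next
    case False
    have "q U = (norm U)\<^sup>2 * q ((1 / norm U) *\<^sub>R U)"
      using False by (simp add: q_scale power_divide)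
    then show ?thesis
      using V0(2)[OF sphere[OF False]] by (simp add: mult_left_mono)
  qed
  have "0 < q V0"
  proof (rule ccontr)
    assume "\<not> 0 < q V0"
    moreover have "norm (H ** V0) \<le> 1"
      using disk_contraction[OF W, of "cnj_mat W ** V0"] disk_contraction[OF disk_cnj[OF W], of V0] V0(1)
      by (simp add: H_def matrix_mul_assoc)
    then have "(norm (H ** V0))\<^sup>2 \<le> 1"
      by (simp add: power_le_one)
    \<comment> \<open>A nonpositive number does not decrease under a factor in
      \<open>[0, 1]\<close>. By homogeneity the right side is at most \<open>q (H ** V0)\<close>,
      while \<open>q_step\<close> makes \<open>q V0\<close> strictly larger than that.\<close>
    ultimately have "q V0 \<le> (norm (H ** V0))\<^sup>2 * q V0"
      using mult_right_mono_neg[of "(norm (H ** V0))\<^sup>2" 1 "q V0"] by simp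
    moreover have "V0 \<noteq> 0"
      using V0(1) by auto
    ultimately show False
      using q_step[of V0] q_ge[of "H ** V0"] Ytr(2)[of V0] by linarith
  qed
  then have "0 < (norm V)\<^sup>2 * q V0"
    using \<open>V \<noteq> 0\<close> by simp
  then show ?thesis
    using q_ge[of V] by (simp add: q_def X_def Y_def)
qed

text \<open>Symmetry of \<open>dW\<close> makes its conjugate its adjoint, so the first summand is
  positive unless \<open>dW = 0\<close>; in that case the coframe reduces to \<open>d\<eta>\<close>,
  which is then nonzero.\<close>

lemma jacobi_form_pos:
  assumes "p \<in> siegel_jacobi_disk" "u \<in> siegel_jacobi_tangent" "u \<noteq> 0"
  shows "0 < Re (jacobi_form p u u)"
proof -
  have W: "fst p \<in> generalized_unit_disk" and U: "transpose (fst u) = fst u"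
    using assms by (auto simp: siegel_jacobi_disk_def siegel_jacobi_tangent_def)
  have U': "transpose (cnj_mat (fst u)) = cnj_mat (fst u)"
    using U by (simp flip: cnj_mat_simps(4))
  let ?V = "transpose (jacobi_coframe p u)"
  have V: "cnj_mat (jacobi_coframe p u) = transpose (cnj_mat ?V)"
    by (simp add: cnj_mat_simps)
  note X = disk_resolvent_pos[OF W]
  show ?thesis
  proof (cases "fst u = 0")
    case True
    then have "?V \<noteq> 0"
      using assms(3) by (auto simp: jacobi_coframe_def prod_eq_iff)
        (metis transpose_transpose transpose_arith(4))
    then show ?thesis
      using trace_gram_pos[OF X, of ?V] V True by (simp add: jacobi_form_def trace_0[unfolded mat_0])
  next
    case False
    then show ?thesis
      using disk_trace_pos[OF W False] trace_gram_nonneg[OF X, of ?V] V U'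
      by (simp add: jacobi_form_def)
  qed
qed

lemma jacobi_form_linear:
  "jacobi_form p (u + v) w = jacobi_form p u w + jacobi_form p v w"
  "jacobi_form p (c *\<^sub>R u) w = c *\<^sub>R jacobi_form p u w"
proof -
  have "jacobi_coframe p (u + v) = jacobi_coframe p u + jacobi_coframe p v"
    "jacobi_coframe p (c *\<^sub>R u) = c *\<^sub>R jacobi_coframe p u"
    by (simp_all add: jacobi_coframe_def matrix_distribs(2) matrix_scalar_ac scaleR_add_right
        flip: scalar_matrix_assoc)
  then show "jacobi_form p (u + v) w = jacobi_form p u w + jacobi_form p v w"
    "jacobi_form p (c *\<^sub>R u) w = c *\<^sub>R jacobi_form p u w"
    by (simp_all add: jacobi_form_def matrix_distribs transpose_arith trace_add transpose_scalar
        matrix_scalar_ac trace_scaleR scaleR_add_right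
        del: scaleR_conv_of_real flip: scalar_matrix_assoc)
qed

section \<open>Openness of the disk and smoothness of the form\<close>

lemma subspace_siegel_jacobi_tangent:
  "subspace (siegel_jacobi_tangent :: ('n::finite, 'm::finite) sj_space set)"
  by (auto simp: subspace_def siegel_jacobi_tangent_def transpose_arith transpose_scalar
      zero_prod_def)

lemma hermitian_pos_def_sphere:
  "hermitian_pos_def A \<longleftrightarrow>
    transpose (cnj_mat A) = A \<and> (\<forall>x\<in>sphere 0 1. 0 < Re (cinner x (A *v x)))"
proof -
  have "0 < Re (cinner x (A *v x))"
    if "\<forall>x\<in>sphere 0 1. 0 < Re (cinner x (A *v x))" "x \<noteq> 0" for x
  proof -
    define y where "y = (1 / norm x) *\<^sub>R x"
    have "0 < Re (cinner y (A *v y))"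
      using that by (simp add: y_def)
    also have "A *v y = (1 / norm x) *\<^sub>R (A *v x)"
      by (simp add: y_def vec_eq_iff matrix_vector_mult_def scaleR_sum_right)
    also have "cinner y \<dots> = (1 / (norm x)\<^sup>2) *\<^sub>R cinner x (A *v x)"
      by (simp add: y_def cinner_def scaleR_sum_right power2_eq_square)
    finally show ?thesis
      using \<open>x \<noteq> 0\<close> by (simp add: zero_less_divide_iff)
  qed
  then show ?thesis
    by (auto simp: hermitian_pos_def_cinner) (metis norm_zero zero_neq_one)
qed

text \<open>For symmetric \<open>W\<close> the Hermitian condition is automatic. Positivity fails on
  the projection of a closed set along the compact unit sphere, hence on a closed set.\<close>

lemma openin_siegel_jacobi_disk:
  "openin (top_of_set siegel_jacobi_tangent)
    (siegel_jacobi_disk :: ('n::finite, 'm::finite) sj_space set)"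
proof -
  let ?f = "\<lambda>x W :: complex ^ 'n ^ 'n. Re (cinner x ((mat 1 - cnj_mat W ** W) *v x))"
  define B where "B = {W. \<exists>x. x \<in> sphere 0 1 \<and> (x, W) \<in> {z. ?f (fst z) (snd z) \<le> 0}}"
  have "closed {z. ?f (fst z) (snd z) \<le> 0}"
    unfolding cinner_def matrix_vector_mult_def matrix_matrix_mult_def
    by (intro closed_Collect_le) (auto intro!: continuous_intros)
  then have "closed B"
    unfolding B_def by (intro closed_compact_projection) auto
  then have "open ((- B) \<times> (UNIV :: (complex ^ 'n ^ 'm) set))"
    by (intro open_Times) auto
  moreover have "siegel_jacobi_disk = siegel_jacobi_tangent \<inter> ((- B) \<times> (UNIV :: (complex ^ 'n ^ 'm) set))"
  proof -
    have "transpose (cnj_mat (mat 1 - cnj_mat W ** W)) = mat 1 - cnj_mat W ** W"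
      if "W = transpose W" for W :: "complex ^ 'n ^ 'n"
    proof -
      have "transpose (cnj_mat W) = cnj_mat W"
        using that by (metis cnj_mat_simps(4))
      then show ?thesis
        using that by (simp add: cnj_mat_simps transpose_arith matrix_transpose_mul)
    qed
    then show ?thesis
      by (auto simp: siegel_jacobi_disk_def siegel_jacobi_tangent_def generalized_unit_disk_def
          hermitian_pos_def_sphere B_def not_le)
        (metis mem_sphere_0 not_less)
  qed
  ultimately show ?thesis
    by (auto simp: openin_open)
qed

text \<open>The local extension required is the same formula, on the open set of all pairs,
  symmetric or not, where both determinants are nonzero. One such set serves every point of the
  disk.\<close>

lemma smooth_jacobi_form:
  fixes u v :: "('n::finite, 'm::finite) sj_space"
  shows "smooth_fun_on siegel_jacobi_disk (\<lambda>p. Re (jacobi_form p u v))"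
proof -
  define U :: "('n, 'm) sj_space set" where "U = {p. det (mat 1 - fst p ** cnj_mat (fst p)) \<noteq> 0} \<inter>
    {p. det (mat 1 - cnj_mat (fst p) ** fst p) \<noteq> 0}"
  note bilin = Ck_on_bilinear[OF bounded_bilinear_matrix_mult]
  note lin = Ck_on_linear[OF bounded_linear_cnj_mat] Ck_on_linear[OF bounded_linear_fst]
    Ck_on_linear[OF bounded_linear_snd] Ck_on_linear[OF bounded_linear_transpose]
    Ck_on_linear[OF bounded_linear_trace] Ck_on_linear[OF bounded_linear_Re]
  have gram: "Ck_on k (\<lambda>p :: ('n, 'm) sj_space. mat 1 - fst p ** cnj_mat (fst p)) S"
    "Ck_on k (\<lambda>p :: ('n, 'm) sj_space. mat 1 - cnj_mat (fst p) ** fst p) S" if "open S" for k S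
    using that by (intro Ck_on_diff Ck_on_const bilin lin Ck_on_ident; simp)+
  have "continuous_on UNIV (\<lambda>p :: ('n, 'm) sj_space. det (mat 1 - fst p ** cnj_mat (fst p)))"
    "continuous_on UNIV (\<lambda>p :: ('n, 'm) sj_space. det (mat 1 - cnj_mat (fst p) ** fst p))"
    using Ck_on_det[OF open_UNIV gram(1)[OF open_UNIV], of 0]
      Ck_on_det[OF open_UNIV gram(2)[OF open_UNIV], of 0] by simp_all
  then have U: "open U"
    unfolding U_def by (intro open_Int open_Collect_neq continuous_on_const)
  have X: "Ck_on k (\<lambda>p. disk_resolvent (fst p)) U" "Ck_on k (\<lambda>p. disk_resolvent (cnj_mat (fst p))) U" for k
    unfolding disk_resolvent_def cnj_mat_simps(5)
    by (intro Ck_on_matrix_inv gram U; simp add: U_def invertible_det_nz)+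
  have theta: "Ck_on k (\<lambda>p. jacobi_coframe p w) U" for k and w :: "('n, 'm) sj_space"
    unfolding jacobi_coframe_def by (intro Ck_on_add Ck_on_diff bilin lin Ck_on_const Ck_on_ident X U)
  have "Ck_on k (\<lambda>p. Re (jacobi_form p u v)) U" for k
    unfolding jacobi_form_def by (intro Ck_on_add bilin lin Ck_on_const Ck_on_ident X theta U)
  moreover have "siegel_jacobi_disk \<subseteq> U"
    using disk_invertible disk_invertible[OF disk_cnj]
    by (auto simp: siegel_jacobi_disk_def U_def cnj_mat_simps simp flip: invertible_det_nz)
  ultimately show ?thesis
    unfolding smooth_fun_on_def using U by blast
qed

section \<open>The action of the Jacobi group\<close>

lemma of_real_mat_mult: "of_real_mat (A ** B) = of_real_mat A ** of_real_mat B"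
  by (simp add: vec_eq_iff matrix_matrix_mult_def)

lemma transpose_block_mat:
  "transpose (block_mat A B C D) = block_mat (transpose A) (transpose C) (transpose B) (transpose D)"
  by (auto simp: vec_eq_iff block_mat_def transpose_def split: sum.splits)

lemma mat_arith:
  fixes a b :: "'a::comm_ring_1"
  shows "mat a ** mat b = mat (a * b)" "mat a + mat b = mat (a + b)" "- mat a = mat (- a)"
  by (simp_all add: mat_mult_left) (simp_all add: mat_def vec_eq_iff)

lemma mat_commute:
  fixes A :: "'a::comm_semiring_1 ^ 'n ^ 'm"
  shows "A ** mat c = mat c ** A"
  by (simp add: mat_mult_left mat_mult_right mult.commute)

text \<open>The Cayley matrix multiplies the standard symplectic form by \<open>-i\<close>, so
  conjugating by it preserves the symplectic condition.\<close>

lemma cayley_symplectic_form: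
  "transpose cayley_mat ** block_mat 0 (mat 1) (- mat 1) 0 ** cayley_mat
    = (block_mat 0 (mat (- \<i>)) (mat \<i>) 0 :: complex ^ ('k::finite + 'k) ^ ('k + 'k))"
  unfolding cayley_mat_alt Let_def transpose_block_mat block_mat_mult
  by (simp add: mat_arith sqrt2_sq)

lemma jacobi_star_relations:
  fixes X :: "(complex, 'n::finite, 'm::finite) jacobi_mat"
  assumes "X \<in> jacobi_group_star"
  defines "P \<equiv> jacobi_P X" and "Q \<equiv> jacobi_Q X"
  shows "transpose P ** cnj_mat Q = transpose (cnj_mat Q) ** P"
    and "transpose (cnj_mat P) ** P - transpose Q ** cnj_mat Q = mat 1"
proof -
  let ?J = "block_mat 0 (mat 1) (- mat 1) 0 :: real ^ ('n + 'n) ^ ('n + 'n)"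
  let ?Jc = "block_mat 0 (mat 1) (- mat 1) 0 :: complex ^ ('n + 'n) ^ ('n + 'n)"
  let ?C = "cayley_mat :: complex ^ ('n + 'n) ^ ('n + 'n)"
  let ?K = "block_mat 0 (mat (- \<i>)) (mat \<i>) 0 :: complex ^ ('n + 'n) ^ ('n + 'n)"
  obtain M l \<mu> \<kappa> where M: "M \<in> symplectic_group"
    and X: "X = matrix_inv cayley_mat ** of_real_mat (jacobi_embedding M (l, \<mu>, \<kappa>)) ** cayley_mat"
    using assms(1) unfolding jacobi_group_star_def jacobi_group_def by auto
  define G where "G = block_mat P Q (cnj_mat Q) (cnj_mat P)"
  have G: "matrix_inv ?C ** of_real_mat M ** ?C = G"
    using jacobi_star_coordinates(1)[of M l \<mu> \<kappa>] by (simp add: G_def P_def Q_def X)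
  have "invertible ?C"
  proof -
    have "?C ** matrix_inv ?C = mat 1"
      unfolding matrix_inv_cayley unfolding cayley_mat_alt Let_def block_mat_mult mat_1_block mat_mult_left
      by (auto simp: vec_eq_iff block_mat_def mat_def sqrt2_sq field_simps split: sum.splits)
    then show ?thesis
      using invertible_right_inverse by blast
  qed
  then have CG: "?C ** G = of_real_mat M ** ?C"
    by (simp add: G[symmetric] matrix_mul_assoc matrix_inv_inverse)
  have "of_real_mat (transpose M ** ?J ** M) = of_real_mat ?J"
    using M by (simp add: symplectic_group_def Let_def)
  moreover have "of_real_mat ?J = ?Jc"
    by (auto simp: vec_eq_iff block_mat_def mat_def split: sum.splits)
  moreover have "of_real_mat (transpose M) = transpose (of_real_mat M)"
    by (simp add: vec_eq_iff transpose_def)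
  ultimately have MJ: "transpose (of_real_mat M) ** ?Jc ** of_real_mat M = ?Jc"
    by (simp add: of_real_mat_mult)
  have "transpose G ** ?K ** G = transpose (?C ** G) ** ?Jc ** (?C ** G)"
    by (simp add: cayley_symplectic_form[symmetric] matrix_transpose_mul matrix_mul_assoc)
  also have "\<dots> = transpose ?C ** (transpose (of_real_mat M) ** ?Jc ** of_real_mat M) ** ?C"
    unfolding CG by (simp add: matrix_transpose_mul matrix_mul_assoc)
  also have "\<dots> = ?K"
    unfolding MJ by (rule cayley_symplectic_form)
  finally have K: "transpose G ** ?K ** G = ?K" .
  have scale: "A ** mat c ** B = mat c ** (A ** B)" for A B :: "complex ^ 'n ^ 'n" and c
    by (simp add: mat_commute matrix_mul_assoc)
  \<comment> \<open>Removes the factors \<open>\<i>\<close> and \<open>- \<i>\<close> that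
    \<open>?K\<close> brings into the two upper blocks.\<close>
  have rot: "B - A = mat \<i> ** (mat \<i> ** A + mat (- \<i>) ** B)" for A B :: "complex ^ 'n ^ 'n"
  proof -
    have "mat (- 1) ** A = - A"
      by (simp add: mat_mult_left vec_eq_iff)
    then show ?thesis
      by (simp add: matrix_distribs matrix_mul_assoc mat_arith)
  qed
  have "block11 (transpose G ** ?K ** G) = 0" "block12 (transpose G ** ?K ** G) = mat (- \<i>)"
    unfolding K by simp_all
  then have "mat \<i> ** (transpose (cnj_mat Q) ** P) + mat (- \<i>) ** (transpose P ** cnj_mat Q) = 0"
    "mat \<i> ** (transpose (cnj_mat Q) ** Q) + mat (- \<i>) ** (transpose P ** cnj_mat P) = mat (- \<i>)"
    unfolding G_def transpose_block_mat block_mat_mult blocks_block_mat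
    by (simp_all add: scale)
  then have 1: "transpose P ** cnj_mat Q = transpose (cnj_mat Q) ** P"
    and 2: "transpose P ** cnj_mat P - transpose (cnj_mat Q) ** Q = mat 1"
    using rot[of "transpose P ** cnj_mat Q" "transpose (cnj_mat Q) ** P"]
      rot[of "transpose P ** cnj_mat P" "transpose (cnj_mat Q) ** Q"]
    by (simp_all add: mat_arith)
  show "transpose P ** cnj_mat Q = transpose (cnj_mat Q) ** P"
    by (rule 1)
  show "transpose (cnj_mat P) ** P - transpose Q ** cnj_mat Q = mat 1"
    using arg_cong[OF 2, of cnj_mat] by (simp add: cnj_mat_simps)
qed

text \<open>Every \<open>\<eta>\<close> is uniquely \<open>s W + cnj s\<close>, and the coframe is \<open>d\<eta> - s dW\<close>; in the coordinate
  \<open>s\<close> the group acts linearly.\<close>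

lemma jacobi_coframe_eq:
  assumes W: "W \<in> generalized_unit_disk" and \<eta>: "\<eta> = s ** W + cnj_mat s"
  shows "jacobi_coframe (W, \<eta>) u = snd u - s ** fst u"
proof -
  have "\<eta> ** cnj_mat W - cnj_mat \<eta> = - (s ** (mat 1 - W ** cnj_mat W))"
    by (simp add: \<eta> cnj_mat_simps matrix_distribs matrix_mul_assoc)
  then have "(\<eta> ** cnj_mat W - cnj_mat \<eta>) ** disk_resolvent W = - s"
    using disk_invertible[OF W]
    by (simp add: disk_resolvent_def matrix_inv_cancel matrix_distribs(5))
  then show ?thesis
    by (simp add: jacobi_coframe_def matrix_distribs)
qed

lemma disk_fibre_coordinate:
  fixes \<eta> :: "complex ^ 'n::finite ^ 'm::finite"
  assumes W: "W \<in> generalized_unit_disk"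
  obtains s where "\<eta> = s ** W + cnj_mat s"
proof
  define X Y where "X = disk_resolvent W" and "Y = disk_resolvent (cnj_mat W)"
  \<comment> \<open>Eliminating \<open>cnj s\<close> from \<open>\<eta> = s W + cnj s\<close> and
    its conjugate leaves \<open>s (1 - W (cnj W)) = cnj \<eta> - \<eta> (cnj W)\<close>.\<close>
  let ?s = "(cnj_mat \<eta> - \<eta> ** cnj_mat W) ** X"
  have Y: "Y - cnj_mat W ** W ** Y = mat 1"
    using matrix_inv_inverse(1)[OF disk_invertible[OF disk_cnj[OF W]]]
    by (simp add: Y_def disk_resolvent_def cnj_mat_simps matrix_distribs)
  have "?s ** W = (cnj_mat \<eta> - \<eta> ** cnj_mat W) ** W ** Y"
    using disk_resolvent_commute(1)[OF W] by (simp add: X_def Y_def flip: matrix_mul_assoc)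
  moreover have "cnj_mat ?s = (\<eta> - cnj_mat \<eta> ** W) ** Y"
    by (simp add: X_def Y_def cnj_mat_simps cnj_disk_resolvent W)
  ultimately have "?s ** W + cnj_mat ?s = \<eta> ** (Y - cnj_mat W ** W ** Y)"
    by (simp add: matrix_distribs matrix_mul_assoc)
  then show "\<eta> = ?s ** W + cnj_mat ?s"
    by (simp add: Y)
qed

section \<open>The fractional linear action on the disk\<close>

locale disk_isometry =
  fixes P Q W :: "complex ^ 'n::finite ^ 'n"
  assumes PQ: "transpose P ** cnj_mat Q = transpose (cnj_mat Q) ** P"
    and PP: "transpose (cnj_mat P) ** P - transpose Q ** cnj_mat Q = mat 1"
    and W: "W \<in> generalized_unit_disk"
begin

text \<open>The block matrix \<open>(P, Q; cnj Q, cnj P)\<close> sends the column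
  \<open>(W; 1)\<close> to \<open>(N; L)\<close>, and \<open>N R\<close> is the affine coordinate of
  the result.\<close>

definition "N = P ** W + Q"
definition "L = cnj_mat Q ** W + cnj_mat P"
definition "R = matrix_inv L"

lemma PQ': "transpose (cnj_mat P) ** Q = transpose Q ** cnj_mat P"
  using arg_cong[OF PQ, of cnj_mat] by (simp add: cnj_mat_simps)

lemma PP': "transpose P ** cnj_mat P - transpose (cnj_mat Q) ** Q = mat 1"
  using arg_cong[OF PP, of cnj_mat] by (simp add: cnj_mat_simps)

text \<open>The group preserves the indefinite Hermitian form whose values on the columns
  \<open>(N; L)\<close> and \<open>(W; 1)\<close> are the two sides.\<close>

lemma gram_diff:
  "transpose (cnj_mat L) ** L - transpose (cnj_mat N) ** N = mat 1 - cnj_mat W ** W"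
proof -
  let ?W = "cnj_mat W"
  have "transpose (cnj_mat L) ** L - transpose (cnj_mat N) ** N
      = - (?W ** (transpose (cnj_mat P) ** P - transpose Q ** cnj_mat Q) ** W)
        + ?W ** (transpose Q ** cnj_mat P - transpose (cnj_mat P) ** Q)
        + (transpose P ** cnj_mat Q - transpose (cnj_mat Q) ** P) ** W
        + (transpose P ** cnj_mat P - transpose (cnj_mat Q) ** Q)"
    by (simp add: L_def N_def cnj_mat_simps transpose_arith matrix_transpose_mul matrix_distribs
        matrix_mul_assoc disk_symmetric[OF W])
  then show ?thesis
    unfolding PP PP' PQ PQ' by simp
qed

text \<open>By \<open>gram_diff\<close> the Gram matrix of \<open>L\<close> is
  \<open>1 - (cnj W) W\<close> plus that of \<open>N\<close>, hence positive definite.\<close>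

lemma L_invertible: "invertible L"
proof -
  have "hermitian_pos_def (mat 1 - cnj_mat W ** W + transpose (cnj_mat N) ** N)"
    using W by (intro hermitian_pos_def_add_gram) (simp add: generalized_unit_disk_def)
  moreover have "mat 1 - cnj_mat W ** W + transpose (cnj_mat N) ** N = transpose (cnj_mat L) ** L"
    using gram_diff by (simp add: algebra_simps)
  ultimately have "invertible (transpose (cnj_mat L) ** L)"
    using hermitian_pos_def_invertible by metis
  then show ?thesis
    by (metis invertible_def invertible_left_inverse matrix_mul_assoc)
qed

lemma LR: "L ** R = mat 1" "R ** L = mat 1"
  using matrix_inv_inverse[OF L_invertible] by (simp_all add: R_def)

lemma transpose_LR: "transpose R ** transpose L = mat 1" "transpose L ** transpose R = mat 1"
  using LR by (simp_all flip: matrix_transpose_mul)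

lemma LR_cancel: "B ** L ** R = B" "B ** R ** L = B"
  "C ** transpose R ** transpose L = C" "C ** transpose L ** transpose R = C"
  using LR transpose_LR by (simp_all flip: matrix_mul_assoc)

text \<open>The alternating form is preserved too, and its vanishing on the column
  \<open>(W; 1)\<close> expresses the symmetry of \<open>W\<close>.\<close>

lemma image_symmetric: "transpose (N ** R) = N ** R"
proof -
  have "transpose L ** N - transpose N ** L
      = W ** (transpose (cnj_mat Q) ** P - transpose P ** cnj_mat Q) ** W
        - W ** (transpose P ** cnj_mat P - transpose (cnj_mat Q) ** Q)
        + (transpose (cnj_mat P) ** P - transpose Q ** cnj_mat Q) ** W
        + (transpose (cnj_mat P) ** Q - transpose Q ** cnj_mat P)"
    by (simp add: L_def N_def transpose_arith matrix_transpose_mul matrix_distribs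
        matrix_mul_assoc disk_symmetric[OF W])
  then have "transpose L ** N = transpose N ** L"
    unfolding PP PP' PQ PQ' by simp
  then have "transpose R ** (transpose L ** N) ** R = transpose R ** (transpose N ** L) ** R"
    by simp
  then have "N ** R = transpose R ** transpose N"
    by (simp add: matrix_mul_assoc transpose_LR LR_cancel)
  then show ?thesis
    by (simp add: matrix_transpose_mul)
qed

lemma image_gram:
  "mat 1 - cnj_mat (N ** R) ** (N ** R) = transpose (cnj_mat R) ** (mat 1 - cnj_mat W ** W) ** R"
proof -
  have "cnj_mat (N ** R) = transpose (cnj_mat (N ** R))"
    using image_symmetric by (metis cnj_mat_simps(4))
  then have *: "cnj_mat (N ** R) = transpose (cnj_mat R) ** transpose (cnj_mat N)"
    by (simp add: cnj_mat_simps matrix_transpose_mul)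
  have 1: "transpose (cnj_mat R) ** transpose (cnj_mat L) = mat 1"
    using transpose_LR(1) by (metis cnj_mat_simps(1,4,6))
  show ?thesis
    unfolding gram_diff[symmetric] *
    by (simp add: matrix_distribs matrix_mul_assoc 1 LR)
qed

lemma image_in_disk: "N ** R \<in> generalized_unit_disk"
proof -
  have "invertible R"
    using LR invertible_def by blast
  then have "hermitian_pos_def (mat 1 - cnj_mat (N ** R) ** (N ** R))"
    unfolding image_gram using W
    by (intro hermitian_pos_def_congruence) (auto simp: generalized_unit_disk_def)
  then show ?thesis
    using image_symmetric by (simp add: generalized_unit_disk_def)
qed

text \<open>The first law is the inverse of \<open>image_gram\<close>; the second is its
  conjugate.\<close>

lemma image_resolvent:
  "disk_resolvent (cnj_mat (N ** R)) = L ** disk_resolvent (cnj_mat W) ** transpose (cnj_mat L)"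
  "disk_resolvent (N ** R) = cnj_mat L ** disk_resolvent W ** transpose L"
proof -
  have 1: "transpose (cnj_mat R) ** transpose (cnj_mat L) = mat 1"
    using transpose_LR(1) by (metis cnj_mat_simps(1,4,6))
  let ?A = "mat 1 - cnj_mat W ** W" and ?Y = "disk_resolvent (cnj_mat W)"
  have A: "?A ** ?Y = mat 1"
    using matrix_inv_inverse(1)[OF disk_invertible[OF disk_cnj[OF W]]]
    by (simp add: disk_resolvent_def cnj_mat_simps)
  have "(transpose (cnj_mat R) ** ?A ** R) ** (L ** ?Y ** transpose (cnj_mat L))
      = transpose (cnj_mat R) ** (?A ** (R ** L) ** ?Y) ** transpose (cnj_mat L)"
    by (simp only: matrix_mul_assoc)
  also have "\<dots> = mat 1"
    by (simp only: LR A matrix_mul_rid 1)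
  finally show *: "disk_resolvent (cnj_mat (N ** R)) = L ** ?Y ** transpose (cnj_mat L)"
    unfolding disk_resolvent_def cnj_mat_simps(5) image_gram
    by (rule matrix_inv_unique)
  have "disk_resolvent (N ** R) = cnj_mat (disk_resolvent (cnj_mat (N ** R)))"
    by (simp add: cnj_disk_resolvent[OF disk_cnj[OF image_in_disk]] cnj_mat_simps(5))
  then show "disk_resolvent (N ** R) = cnj_mat L ** disk_resolvent W ** transpose L"
    unfolding * by (simp add: cnj_mat_simps cnj_disk_resolvent disk_cnj W)
qed

text \<open>The left side is the coefficient before \<open>dW R\<close> in the differential of
  \<open>N R\<close>, so this yields the law \<open>dW \<mapsto> R^t dW R\<close>.\<close>

lemma image_differential: "P - N ** R ** cnj_mat Q = transpose R"
proof -
  have "transpose L ** P - transpose N ** cnj_mat Q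
     = W ** (transpose (cnj_mat Q) ** P - transpose P ** cnj_mat Q)
       + (transpose (cnj_mat P) ** P - transpose Q ** cnj_mat Q)"
    by (simp add: L_def N_def transpose_arith matrix_transpose_mul matrix_distribs
        matrix_mul_assoc disk_symmetric[OF W])
  then have *: "transpose L ** P - transpose N ** cnj_mat Q = mat 1"
    unfolding PP PQ by simp
  have "N ** R = transpose R ** transpose N"
    using image_symmetric by (simp add: matrix_transpose_mul)
  then have "P - N ** R ** cnj_mat Q = transpose R ** (transpose L ** P - transpose N ** cnj_mat Q)"
    by (simp add: matrix_distribs matrix_mul_assoc transpose_LR)
  then show ?thesis
    by (simp add: *)
qed

end

section \<open>The action on the fibre variable and its derivative\<close>

locale jacobi_isometry = disk_isometry P Q W
  for P Q W :: "complex ^ 'n::finite ^ 'n" +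
  fixes \<xi> \<eta> :: "complex ^ 'n ^ 'm::finite"
begin

definition "E = (\<eta> + \<xi> ** W + cnj_mat \<xi>) ** R"

text \<open>The derivative of the action by the product rule, with
  \<open>dR = - R (cnj Q) dW R\<close>.\<close>

definition D :: "('n, 'm) sj_space \<Rightarrow> ('n, 'm) sj_space"
  where "D u = ((P - N ** R ** cnj_mat Q) ** fst u ** R,
    (snd u + \<xi> ** fst u - E ** cnj_mat Q ** fst u) ** R)"

lemma D_tangent:
  assumes "u \<in> siegel_jacobi_tangent"
  shows "D u \<in> siegel_jacobi_tangent"
proof -
  have "transpose (fst u) = fst u"
    using assms by (auto simp: siegel_jacobi_tangent_def)
  then show ?thesis
    by (simp add: D_def siegel_jacobi_tangent_def image_differential matrix_transpose_mul
        matrix_mul_assoc)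
qed

lemma coframe_D: "jacobi_coframe (N ** R, E) (D u) = jacobi_coframe (W, \<eta>) u ** R"
proof -
  obtain s where s: "\<eta> = s ** W + cnj_mat s"
    using disk_fibre_coordinate[OF W] .
  \<comment> \<open>The pair \<open>(t, cnj t)\<close> is the row
    \<open>(\<sigma>, cnj \<sigma>)\<close> times the inverse of
    \<open>(P, Q; cnj Q, cnj P)\<close>; it turns out that \<open>t\<close> is the fibre coordinate
    of the image point.\<close>
  define \<sigma> t where "\<sigma> = s + \<xi>"
    and "t = \<sigma> ** transpose (cnj_mat P) - cnj_mat \<sigma> ** transpose (cnj_mat Q)"
  have t: "t ** P + cnj_mat t ** cnj_mat Q = \<sigma>"
  proof -
    have "t ** P + cnj_mat t ** cnj_mat Q
        = \<sigma> ** (transpose (cnj_mat P) ** P - transpose Q ** cnj_mat Q)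
          + cnj_mat \<sigma> ** (transpose P ** cnj_mat Q - transpose (cnj_mat Q) ** P)"
      by (simp add: t_def cnj_mat_simps matrix_distribs matrix_mul_assoc)
    then show ?thesis
      unfolding PP PQ by simp
  qed
  have t': "t ** Q + cnj_mat t ** cnj_mat P = cnj_mat \<sigma>"
    using arg_cong[OF t, of cnj_mat] by (simp add: cnj_mat_simps add.commute)
  have "E = (\<sigma> ** W + cnj_mat \<sigma>) ** R"
    unfolding E_def by (simp add: s \<sigma>_def cnj_mat_simps matrix_distribs add_ac)
  also have "\<sigma> ** W + cnj_mat \<sigma>
      = (t ** P + cnj_mat t ** cnj_mat Q) ** W + (t ** Q + cnj_mat t ** cnj_mat P)"
    unfolding t t' ..
  also have "\<dots> = t ** N + cnj_mat t ** L"
    by (simp add: N_def L_def matrix_distribs matrix_mul_assoc)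
  finally have E: "E = t ** (N ** R) + cnj_mat t"
    by (simp add: matrix_distribs matrix_mul_assoc LR_cancel)
  have "jacobi_coframe (N ** R, E) (D u)
      = (snd u + \<xi> ** fst u - E ** cnj_mat Q ** fst u) ** R
        - t ** ((P - N ** R ** cnj_mat Q) ** fst u ** R)"
    unfolding jacobi_coframe_eq[OF image_in_disk E] by (simp add: D_def)
  also have "\<dots> = (snd u + \<xi> ** fst u - (t ** P + cnj_mat t ** cnj_mat Q) ** fst u) ** R"
    unfolding E by (simp add: matrix_distribs matrix_mul_assoc)
  also have "\<dots> = (snd u - s ** fst u) ** R"
    unfolding t by (simp add: \<sigma>_def matrix_distribs)
  finally show ?thesis
    unfolding jacobi_coframe_eq[OF W s] .
qed

lemma form_D:
  "jacobi_form (N ** R, E) (D u) (D v) = jacobi_form (W, \<eta>) u v"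
proof -
  have c: "B ** cnj_mat R ** cnj_mat L = B" "B ** transpose (cnj_mat L) ** transpose (cnj_mat R) = B"
    for B :: "complex ^ 'n ^ 'k::finite"
    using LR_cancel(2)[of "cnj_mat B"] LR_cancel(4)[of "cnj_mat B"]
    by (metis cnj_mat_simps(1,4,5))+
  let ?X = "disk_resolvent W" and ?Y = "disk_resolvent (cnj_mat W)"
  have "trace ((cnj_mat L ** ?X ** transpose L) ** (transpose R ** fst u ** R)
        ** (L ** ?Y ** transpose (cnj_mat L)) ** cnj_mat (transpose R ** fst v ** R))
      = trace (cnj_mat L ** (?X ** fst u ** ?Y ** cnj_mat (fst v) ** cnj_mat R))"
    by (simp add: matrix_mul_assoc cnj_mat_simps LR_cancel c)
  \<comment> \<open>The outer factors \<open>cnj L\<close> and \<open>cnj R\<close> meet only after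
    a cyclic rotation.\<close>
  also have "\<dots> = trace (?X ** fst u ** ?Y ** cnj_mat (fst v))"
    by (subst trace_mul_sym) (simp add: matrix_mul_assoc c)
  finally have 1: "trace (disk_resolvent (N ** R) ** fst (D u) ** disk_resolvent (cnj_mat (N ** R))
      ** cnj_mat (fst (D v))) = trace (?X ** fst u ** ?Y ** cnj_mat (fst v))"
    by (simp add: D_def image_differential image_resolvent)
  have 2: "cnj_mat (\<theta>' ** R) ** disk_resolvent (N ** R) ** transpose (\<theta> ** R)
      = cnj_mat \<theta>' ** ?X ** transpose \<theta>" for \<theta> \<theta>' :: "complex ^ 'n ^ 'm"
    by (simp add: image_resolvent cnj_mat_simps matrix_transpose_mul matrix_mul_assoc LR_cancel c)
  show ?thesis
    unfolding jacobi_form_def coframe_D fst_conv 1 2 ..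
qed

end

section \<open>Invariance and the metric axioms\<close>

lemma jacobi_action_isometry:
  fixes X :: "(complex, 'n::finite, 'm::finite) jacobi_mat"
  assumes "X \<in> jacobi_group_star" "W \<in> generalized_unit_disk"
  shows "disk_isometry (jacobi_P X) (jacobi_Q X) W"
  using jacobi_star_relations[OF assms(1)] assms(2) by unfold_locales

lemma metric_invariant_jacobi_action:
  fixes X :: "(complex, 'n::finite, 'm::finite) jacobi_mat"
  assumes X: "X \<in> jacobi_group_star"
  shows "metric_invariant_under siegel_jacobi_disk siegel_jacobi_tangent
    (\<lambda>p u v. Re (siegel_jacobi_ds2 p u v)) (jacobi_action X)"
  unfolding metric_invariant_under_def
proof (intro conjI ballI subsetI)
  define P Q \<xi> where "P = jacobi_P X" and "Q = jacobi_Q X" and "\<xi> = jacobi_xi X"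
  define R0 where "R0 p = matrix_inv (cnj_mat Q ** fst p + cnj_mat P)" for p :: "('n, 'm) sj_space"
  have action: "jacobi_action X = (\<lambda>p. ((P ** fst p + Q) ** R0 p,
      (snd p + \<xi> ** fst p + cnj_mat \<xi>) ** R0 p))"
    by (auto simp: jacobi_action_def P_def Q_def \<xi>_def R0_def Let_def split: prod.splits)
  have iso: "disk_isometry P Q (fst p)" if "p \<in> siegel_jacobi_disk" for p :: "('n, 'm) sj_space"
    using that jacobi_action_isometry[OF X] by (auto simp: siegel_jacobi_disk_def P_def Q_def)
  have maps: "jacobi_action X p \<in> siegel_jacobi_disk" if p: "p \<in> siegel_jacobi_disk" for p
  proof -
    interpret disk_isometry P Q "fst p"
      by (rule iso[OF p])
    show ?thesis
      using image_in_disk by (simp add: siegel_jacobi_disk_def action N_def R_def R0_def L_def)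
  qed
  show "p \<in> siegel_jacobi_disk" if "p \<in> jacobi_action X ` siegel_jacobi_disk" for p
    using that maps by blast
  fix p :: "('n, 'm) sj_space"
  assume p: "p \<in> siegel_jacobi_disk"
  interpret disk_isometry P Q "fst p"
    by (rule iso[OF p])
  interpret jacobi_isometry P Q "fst p" \<xi> "snd p"
    by unfold_locales
  have R0: "R0 p = R"
    by (simp add: R0_def R_def L_def)
  have image: "jacobi_action X p = (N ** R, E)"
    by (simp add: action R0 N_def E_def)
  note mult = bounded_bilinear.FDERIV[OF bounded_bilinear_matrix_mult]
  have lin: "((\<lambda>p :: ('n, 'm) sj_space. A ** fst p) has_derivative (\<lambda>u. A ** fst u)) F"
    for A :: "complex ^ 'n ^ 'k::finite" and F
    by (intro bounded_linear_imp_has_derivative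
        bounded_linear_compose[OF bounded_bilinear.bounded_linear_right[OF bounded_bilinear_matrix_mult]
          bounded_linear_fst])
  have dL: "((\<lambda>p. cnj_mat Q ** fst p + cnj_mat P) has_derivative (\<lambda>u. cnj_mat Q ** fst u))
      (at p within siegel_jacobi_disk)"
    using has_derivative_add[OF lin has_derivative_const] by simp
  have dR: "(R0 has_derivative (\<lambda>u. - (R ** (cnj_mat Q ** fst u) ** R))) (at p within siegel_jacobi_disk)"
    using has_derivative_matrix_inv[OF dL] L_invertible by (simp add: R0_def[abs_def] R_def L_def)
  have dN: "((\<lambda>p. P ** fst p + Q) has_derivative (\<lambda>u. P ** fst u)) (at p within siegel_jacobi_disk)"
    using has_derivative_add[OF lin has_derivative_const] by simp
  have dE: "((\<lambda>p. snd p + \<xi> ** fst p + cnj_mat \<xi>) has_derivative (\<lambda>u. snd u + \<xi> ** fst u))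
      (at p within siegel_jacobi_disk)"
    using has_derivative_add[OF has_derivative_add[OF has_derivative_snd[OF has_derivative_ident] lin]
        has_derivative_const] by simp
  have "(jacobi_action X has_derivative D) (at p within siegel_jacobi_disk)"
    unfolding action
    by (rule has_derivative_eq_rhs[OF has_derivative_Pair[OF mult[OF dN dR] mult[OF dE dR]]])
      (simp add: fun_eq_iff D_def R0 N_def[symmetric] E_def matrix_distribs matrix_mul_assoc)
  \<comment> \<open>The passage to the Hermitian form at the image point requires \<open>D u\<close>
    and \<open>D v\<close> to be tangent, that is, to have symmetric first components.\<close>
  moreover have "Re (siegel_jacobi_ds2 (jacobi_action X p) (D u) (D v)) = Re (siegel_jacobi_ds2 p u v)"
    if "u \<in> siegel_jacobi_tangent" "v \<in> siegel_jacobi_tangent" for u v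
    using siegel_jacobi_ds2_eq[OF maps[OF p] D_tangent[OF that(1)] D_tangent[OF that(2)]]
      siegel_jacobi_ds2_eq[OF p that] form_D[of u v] by (simp add: image)
  ultimately show "\<exists>D. (jacobi_action X has_derivative D) (at p within siegel_jacobi_disk) \<and>
      (\<forall>u\<in>siegel_jacobi_tangent. \<forall>v\<in>siegel_jacobi_tangent.
        Re (siegel_jacobi_ds2 (jacobi_action X p) (D u) (D v)) = Re (siegel_jacobi_ds2 p u v))"
    by blast
qed

lemma riemannian_metric_siegel_jacobi:
  "riemannian_metric_on (siegel_jacobi_disk :: ('n::finite, 'm::finite) sj_space set)
    siegel_jacobi_tangent (\<lambda>p u v. Re (siegel_jacobi_ds2 p u v))"
proof -
  note T = subspace_siegel_jacobi_tangent
  have "smooth_fun_on siegel_jacobi_disk (\<lambda>p. Re (siegel_jacobi_ds2 p u v))"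
    if "u \<in> siegel_jacobi_tangent" "v \<in> siegel_jacobi_tangent" for u v :: "('n, 'm) sj_space"
  proof -
    \<comment> \<open>The factor 4 of the metric is absorbed into the first vector by
      linearity.\<close>
    have "smooth_fun_on siegel_jacobi_disk (\<lambda>p. Re (jacobi_form p (4 *\<^sub>R u) v))"
      by (rule smooth_jacobi_form)
    then show ?thesis
      using siegel_jacobi_ds2_eq[OF _ that]
      unfolding smooth_fun_on_def by (simp add: jacobi_form_linear(2))
  qed
  moreover have "Re (jacobi_form p u v) = Re (jacobi_form p v u)"
    if "p \<in> siegel_jacobi_disk" for p u v :: "('n, 'm) sj_space"
    by (subst jacobi_form_hermitian[OF that]) simp
  ultimately show ?thesis
    unfolding riemannian_metric_on_def
    using jacobi_form_pos
    by (auto simp: siegel_jacobi_ds2_eq jacobi_form_linear subspace_add[OF T] subspace_scale[OF T]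
        T openin_siegel_jacobi_disk)
qed

theorem theorem5p3:
  shows "(\<forall>p \<in> (siegel_jacobi_disk :: ('n::finite, 'm::finite) sj_space set).
            \<forall>u \<in> siegel_jacobi_tangent. \<forall>v \<in> siegel_jacobi_tangent.
              siegel_jacobi_ds2 p u v \<in> \<real>) \<and>
         riemannian_metric_on
           (siegel_jacobi_disk :: ('n::finite, 'm::finite) sj_space set)
           siegel_jacobi_tangent (\<lambda>p u v. Re (siegel_jacobi_ds2 p u v)) \<and>
         (\<forall>X \<in> (jacobi_group_star :: (complex, 'n, 'm) jacobi_mat set).
            metric_invariant_under siegel_jacobi_disk siegel_jacobi_tangent
              (\<lambda>p u v. Re (siegel_jacobi_ds2 p u v)) (jacobi_action X))"
  by (simp add: siegel_jacobi_ds2_eq riemannian_metric_siegel_jacobi metric_invariant_jacobi_action)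

end
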